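(* Let $G=(V,E)$ be a $\sigma$-algebraic graph. Then the following are equivalent: (1) $\chi_\ell(G)\le \aleph_0$; (2) $\mathrm{Col}(G)\le \aleph_0$; (3) $G$ does not contain a $K(\aleph_0,2^{\aleph_0})$.
   Context: A graph $G=(V,E)$ consists of a (possibly infinite) vertex set $V$ and a symmetric, irreflexive relation $E\subseteq V^2$. A coloring $\varphi$ of $G$ (a function with domain $V$) is proper if $\varphi(x)\ne\varphi(y)$ whenever $\langle x,y\rangle\in E$. For a cardinal $\kappa$, a $\kappa$-listing of $G$ is a function $\Lambda$ on $V$ such that $\Lambda(x)$ is a set with $|\Lambda(x)|=\kappa$ for every $x\in V$; a $\Lambda$-coloring is a coloring $\varphi$ with $\varphi(x)\in\Lambda(x)$ for all $x\in V$. The list-chromatic number $\chi_\ell(G)$ is the least cardinal $\kappa$ such that for every $\kappa$-listing $\Lambda$ of $G$ there is a proper $\Lambda$-coloring of $G$. The coloring number $\mathrm{Col}(G)$ is the least cardinal $\kappa$ for which there is a well-ordering $\prec$ of $V$ such that $|\{y\in V:\langle x,y\rangle\in E \text{ and } y\prec x\}|<\kappa$ for every $x\in V$. $G_1=(V_1,E_1)$ is a subgraph of $G_2=(V_2,E_2)$ if $V_1\subseteq V_2$ and $E_1\subseteq E_2$ (not necessarily induced); $G_2$ contains a $G_1$ if $G_2$ has a subgraph isomorphic to $G_1$. $K(\kappa,\lambda)$ is the complete bipartite graph with parts of cardinality $\kappa$ and $\lambda$. A set $X\subseteq\mathbb{R}^n$ is algebraic if it is the set of zeroes of some polynomial (in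 $n$ variables) over $\mathbb{R}$, and $\sigma$-algebraic if it is a union of countably many algebraic subsets of $\mathbb{R}^n$. A graph $(V,E)$, with $V\subseteq\mathbb{R}^n$ for some $n<\omega$ and $E\subseteq V^2\subseteq\mathbb{R}^{2n}$, is $\sigma$-algebraic if both $V$ and $E$ are $\sigma$-algebraic. *)

theory Defs
  imports "HOL-Analysis.Analysis" "HOL-Library.Poly_Mapping"
begin

unbundle cardinal_syntax

section \<open>Graphs\<close>

type_synonym 'a graph = "'a set \<times> 'a rel"

definition is_graph :: "'a graph \<Rightarrow> bool" where
  "is_graph G \<longleftrightarrow> snd G \<subseteq> fst G \<times> fst G \<and> sym (snd G) \<and> irrefl (snd G)"

definition is_subgraph :: "'a graph \<Rightarrow> 'a graph \<Rightarrow> bool" where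
  "is_subgraph G1 G2 \<longleftrightarrow>
     is_graph G1 \<and> is_graph G2 \<and> fst G1 \<subseteq> fst G2 \<and> snd G1 \<subseteq> snd G2"

definition graph_isomorphic :: "'a graph \<Rightarrow> 'b graph \<Rightarrow> bool" where
  "graph_isomorphic G1 G2 \<longleftrightarrow>
     (\<exists>f. bij_betw f (fst G1) (fst G2) \<and>
        (\<forall>x\<in>fst G1. \<forall>y\<in>fst G1. (x, y) \<in> snd G1 \<longleftrightarrow> (f x, f y) \<in> snd G2))"

definition contains_graph :: "'a graph \<Rightarrow> 'b graph \<Rightarrow> bool" where
  "contains_graph G2 G1 \<longleftrightarrow> (\<exists>H. is_subgraph H G2 \<and> graph_isomorphic H G1)"

definition complete_bipartite :: "'a set \<Rightarrow> 'b set \<Rightarrow> ('a + 'b) graph" where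
  "complete_bipartite A B =
     (A <+> B, Inl ` A \<times> Inr ` B \<union> Inr ` B \<times> Inl ` A)"

definition K_aleph0_continuum :: "(nat + nat set) graph" where
  "K_aleph0_continuum = complete_bipartite (UNIV :: nat set) (UNIV :: nat set set)"

section \<open>Cardinal invariants\<close>

text \<open>
  Cardinals are represented as in the BNF cardinal library, by cardinal orders up to \<open>=o\<close>,
  and \<open>natLeq\<close> is \<open>\<aleph>\<^sub>0\<close>. The least cardinal with a property is a representative chosen among
  the cardinal orders on subsets of a given type. Both invariants below are at most \<open>|V|\<close>
  (lemmas \<open>coloring_number_exists\<close> and \<open>list_chromatic_number_exists\<close>), so cardinal orders on
  the vertex type suffice.
\<close>

definition is_least_cardinal :: "('a rel \<Rightarrow> bool) \<Rightarrow> 'a rel \<Rightarrow> bool" where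
  "is_least_cardinal P \<kappa> \<longleftrightarrow>
     Card_order \<kappa> \<and> P \<kappa> \<and> (\<forall>\<mu>. Card_order \<mu> \<and> P \<mu> \<longrightarrow> \<kappa> \<le>o \<mu>)"

definition least_cardinal :: "('a rel \<Rightarrow> bool) \<Rightarrow> 'a rel" where
  "least_cardinal P = (SOME \<kappa>. is_least_cardinal P \<kappa>)"

definition proper_coloring :: "'a graph \<Rightarrow> ('a \<Rightarrow> 'c) \<Rightarrow> bool" where
  "proper_coloring G \<phi> \<longleftrightarrow> (\<forall>(x, y)\<in>snd G. \<phi> x \<noteq> \<phi> y)"

definition is_listing :: "'k rel \<Rightarrow> 'a graph \<Rightarrow> ('a \<Rightarrow> 'c set) \<Rightarrow> bool" where
  "is_listing \<kappa> G \<Lambda> \<longleftrightarrow> (\<forall>x\<in>fst G. |\<Lambda> x| =o \<kappa>)"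

definition list_coloring :: "'a graph \<Rightarrow> ('a \<Rightarrow> 'c set) \<Rightarrow> ('a \<Rightarrow> 'c) \<Rightarrow> bool" where
  "list_coloring G \<Lambda> \<phi> \<longleftrightarrow> (\<forall>x\<in>fst G. \<phi> x \<in> \<Lambda> x)"

text \<open>
  Colors are taken from \<open>'a + nat\<close>. This is no restriction: for a listing of \<open>G\<close> with lists of
  size at most \<open>|UNIV :: 'a set|\<close>, the union of all lists embeds into \<open>'a + nat\<close>.
\<close>

definition choosable :: "'a graph \<Rightarrow> 'a rel \<Rightarrow> bool" where
  "choosable G \<kappa> \<longleftrightarrow>
     (\<forall>\<Lambda> :: 'a \<Rightarrow> ('a + nat) set. is_listing \<kappa> G \<Lambda> \<longrightarrow>
        (\<exists>\<phi>. proper_coloring G \<phi> \<and> list_coloring G \<Lambda> \<phi>))"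

definition list_chromatic_number :: "'a graph \<Rightarrow> 'a rel" where
  "list_chromatic_number G = least_cardinal (choosable G)"

definition has_coloring_order :: "'a graph \<Rightarrow> 'a rel \<Rightarrow> bool" where
  "has_coloring_order G \<kappa> \<longleftrightarrow>
     (\<exists>r. well_order_on (fst G) r \<and>
        (\<forall>x\<in>fst G. |{y \<in> fst G. (x, y) \<in> snd G \<and> y \<in> underS r x}| <o \<kappa>))"

definition coloring_number :: "'a graph \<Rightarrow> 'a rel" where
  "coloring_number G = least_cardinal (has_coloring_order G)"

lemma least_cardinalI:
  assumes "Card_order \<kappa>" "P \<kappa>"
  shows "is_least_cardinal P (least_cardinal P)"
proof -
  let ?R = "{\<mu>. Card_order \<mu> \<and> P \<mu>}"
  have "\<exists>r\<in>?R. \<forall>r'\<in>?R. r \<le>o r'"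
    by (rule exists_minim_Card_order) (use assms in auto)
  then have "\<exists>\<mu>. is_least_cardinal P \<mu>"
    unfolding is_least_cardinal_def by blast
  then show ?thesis
    unfolding least_cardinal_def by (rule someI_ex)
qed

lemma has_coloring_order_card: "has_coloring_order G |fst G|"
  unfolding has_coloring_order_def
proof (intro exI conjI ballI)
  show "well_order_on (fst G) |fst G|"
    by (rule card_of_well_order_on)
  fix x assume "x \<in> fst G"
  then have "|underS |fst G| x| <o |fst G|"
    using card_of_underS[OF card_of_Card_order, of x "fst G"] by (simp add: Field_card_of)
  moreover have "|{y \<in> fst G. (x, y) \<in> snd G \<and> y \<in> underS |fst G| x}| \<le>o |underS |fst G| x|"
    by (rule card_of_mono1) auto
  ultimately show "|{y \<in> fst G. (x, y) \<in> snd G \<and> y \<in> underS |fst G| x}| <o |fst G|"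
    using ordLeq_ordLess_trans by blast
qed

lemma choosable_if_has_coloring_order:
  assumes G: "is_graph G" and H: "has_coloring_order G \<kappa>"
  shows "choosable G \<kappa>"
  unfolding choosable_def
proof (intro allI impI)
  fix \<Lambda> :: "'a \<Rightarrow> ('a + nat) set"
  assume L: "is_listing \<kappa> G \<Lambda>"
  obtain r where r: "well_order_on (fst G) r"
    and small: "\<And>x. x \<in> fst G \<Longrightarrow> |{y \<in> fst G. (x, y) \<in> snd G \<and> y \<in> underS r x}| <o \<kappa>"
    using H unfolding has_coloring_order_def by blast
  define N where "N x = {y \<in> fst G. (x, y) \<in> snd G \<and> y \<in> underS r x}" for x
  let ?P = "\<lambda>f x c. x \<in> fst G \<longrightarrow> c \<in> \<Lambda> x - f ` N x"
  have "\<exists>f. \<forall>x. ?P f x (f x)"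
  proof (rule dependent_wf_choice)
    show "wf (r - Id)"
      using r unfolding well_order_on_def by blast
  next
    fix f g :: "'a \<Rightarrow> 'a + nat" and x c
    assume "\<And>z. (z, x) \<in> r - Id \<Longrightarrow> f z = g z"
    then have "f ` N x = g ` N x"
      unfolding N_def underS_def by (intro image_cong) auto
    then show "?P f x c = ?P g x c" by simp
  next
    fix x and f :: "'a \<Rightarrow> 'a + nat"
    show "\<exists>c. ?P f x c"
    proof (rule ccontr)
      assume *: "\<not> ?thesis"
      then have x: "x \<in> fst G" and sub: "\<Lambda> x \<subseteq> f ` N x" by auto
      have "|\<Lambda> x| \<le>o |f ` N x|" using sub by (rule card_of_mono1)
      moreover have "|f ` N x| \<le>o |N x|" by (rule card_of_image)
      moreover have "|N x| <o \<kappa>" using small[OF x] unfolding N_def .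
      moreover have "\<kappa> =o |\<Lambda> x|"
        using L x unfolding is_listing_def by (blast intro: ordIso_symmetric)
      ultimately have "|\<Lambda> x| <o |\<Lambda> x|"
        by (meson ordLeq_transitive ordLeq_ordLess_trans ordLess_ordIso_trans)
      then show False using ordLess_irreflexive by blast
    qed
  qed
  then obtain f where f: "\<And>x. x \<in> fst G \<Longrightarrow> f x \<in> \<Lambda> x - f ` N x" by blast
  have "f x \<noteq> f y" if e: "(x, y) \<in> snd G" for x y
  proof -
    have V: "x \<in> fst G" "y \<in> fst G" and e': "(y, x) \<in> snd G" and ne: "x \<noteq> y"
      using G e unfolding is_graph_def by (auto dest: symD irreflD)
    have "(x, y) \<in> r \<or> (y, x) \<in> r"
      using r V ne unfolding well_order_on_def linear_order_on_def total_on_def by blast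
    then have "x \<in> N y \<or> y \<in> N x"
      using V e e' ne unfolding N_def underS_def by auto
    then have "f x \<in> f ` N y \<or> f y \<in> f ` N x" by blast
    then show ?thesis using f[OF V(1)] f[OF V(2)] by (metis DiffD2)
  qed
  then show "\<exists>\<phi>. proper_coloring G \<phi> \<and> list_coloring G \<Lambda> \<phi>"
    using f unfolding proper_coloring_def list_coloring_def by blast
qed

lemma coloring_number_exists:
  "is_least_cardinal (has_coloring_order G) (coloring_number G)"
  unfolding coloring_number_def
  by (rule least_cardinalI, rule card_of_Card_order, rule has_coloring_order_card)

lemma list_chromatic_number_exists:
  assumes "is_graph G"
  shows "is_least_cardinal (choosable G) (list_chromatic_number G)"
  unfolding list_chromatic_number_def
  by (rule least_cardinalI, rule card_of_Card_order,
      rule choosable_if_has_coloring_order[OF assms], rule has_coloring_order_card)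

section \<open>Algebraic and \<open>\<sigma>\<close>-algebraic sets\<close>

text \<open>
  Points of \<open>\<real>\<^sup>n\<close> are real lists of length \<open>n\<close>, so that \<open>n\<close> is an arbitrary natural number
  (including 0) and \<open>\<real>\<^sup>n \<times> \<real>\<^sup>n\<close> is identified with \<open>\<real>\<^sup>2\<^sup>n\<close> by concatenation. A polynomial maps
  each monomial (a finitely supported exponent function) to its coefficient.
\<close>

type_synonym real_mpoly = "(nat \<Rightarrow>\<^sub>0 nat) \<Rightarrow>\<^sub>0 real"

definition mpoly_vars :: "real_mpoly \<Rightarrow> nat set" where
  "mpoly_vars p = (\<Union>m\<in>Poly_Mapping.keys p. Poly_Mapping.keys m)"

definition mpoly_eval :: "real_mpoly \<Rightarrow> real list \<Rightarrow> real" where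
  "mpoly_eval p x =
     (\<Sum>m\<in>Poly_Mapping.keys p. Poly_Mapping.lookup p m *
        (\<Prod>i\<in>Poly_Mapping.keys m. (x ! i) ^ Poly_Mapping.lookup m i))"

definition algebraic_set :: "nat \<Rightarrow> real list set \<Rightarrow> bool" where
  "algebraic_set n X \<longleftrightarrow>
     (\<exists>p. mpoly_vars p \<subseteq> {..<n} \<and> X = {x. length x = n \<and> mpoly_eval p x = 0})"

definition sigma_algebraic_set :: "nat \<Rightarrow> real list set \<Rightarrow> bool" where
  "sigma_algebraic_set n X \<longleftrightarrow>
     (\<exists>F. countable F \<and> (\<forall>A\<in>F. algebraic_set n A) \<and> X = \<Union>F)"

definition sigma_algebraic_graph :: "real list graph \<Rightarrow> bool" where
  "sigma_algebraic_graph G \<longleftrightarrow> is_graph G \<and>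
     (\<exists>n. sigma_algebraic_set n (fst G) \<and>
          sigma_algebraic_set (2 * n) ((\<lambda>(x, y). x @ y) ` snd G))"

end

theory Submission
  imports Defs "HOL-Library.Countable_Set_Type" "HOL-Library.Function_Algebras"
    "HOL-Computational_Algebra.Polynomial"
begin

text \<open>
  The coloring number bounds the list-chromatic number for every graph, and a graph containing
  \<open>K(\<aleph>\<^sub>0, 2\<^sup>\<aleph>\<^sup>0)\<close> is not choosable from countable lists (\<open>not_choosable_if_contains_K\<close>): the lists on
  the small side are disjoint, and every way of colouring that side spoils the list of some vertex on
  the large side. The substance is the remaining implication, that a \<open>\<sigma>\<close>-algebraic graph without
  a \<open>K(\<aleph>\<^sub>0, 2\<^sup>\<aleph>\<^sup>0)\<close> has a well-ordering in which every vertex has finitely many smaller neighbours.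

  Write the vertex set and the edge relation as countable unions of algebraic pieces. Call a set \<open>K\<close>
  of vertices closed if it contains every countable set that is defined inside one piece of the
  vertex set by finitely many conditions, each requiring that a given edge piece joins the point to a
  given \<open>y\<close> in \<open>K\<close>. The claim is
  that a vertex \<open>x\<close> outside a closed set \<open>K\<close> has finitely many neighbours in \<open>K\<close>
  (\<open>contains_K_if_infinite_back_neighbours\<close>). Given infinitely many, \<open>x\<close> solves the system of polynomial
  equations saying that a point is joined to all of them by the same pieces as \<open>x\<close>. By Hilbert's basis
  theorem (\<open>noetherian_adjoin\<close>, \<open>finite_subsystem\<close>) a finite part of the system has the same
  solutions. As \<open>x\<close> is not in \<open>K\<close>, there are uncountably many solutions, and these form a closed subset of
  Euclidean space, so there are continuum many (\<open>uncountable_closed_lepoll\<close>). All of them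
  are joined to the infinitely many neighbours of \<open>x\<close>, which gives a \<open>K(\<aleph>\<^sub>0, 2\<^sup>\<aleph>\<^sup>0)\<close>.

  There are countably many pieces, so a set of infinite cardinality \<open>\<mu>\<close> has a closure of cardinality
  \<open>\<mu>\<close>. An uncountable closed set is therefore the union of a chain of smaller closed sets, and
  induction on the cardinality assembles the required well-ordering (\<open>finite_back_degree_closed\<close>).
\<close>

section \<open>Closure under operations and well-orderings\<close>

text \<open>
  A family of operations is coded by one map \<open>C\<close>: the set \<open>C ys\<close> collects everything that the tuple
  \<open>ys\<close> produces. Letting \<open>C ys\<close> be a countable set merges countably many finitary operations,
  so that closures have the cardinality estimate of a countable language.
\<close>
inductive_set op_closure :: "('a list \<Rightarrow> 'a set) \<Rightarrow> 'a set \<Rightarrow> 'a set"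
  for C :: "'a list \<Rightarrow> 'a set" and X :: "'a set" where
  base: "x \<in> X \<Longrightarrow> x \<in> op_closure C X"
| step: "ys \<in> lists (op_closure C X) \<Longrightarrow> x \<in> C ys \<Longrightarrow> x \<in> op_closure C X"
monos lists_mono

definition op_closed :: "('a list \<Rightarrow> 'a set) \<Rightarrow> 'a set \<Rightarrow> bool" where
  "op_closed C K \<longleftrightarrow> (\<forall>ys\<in>lists K. C ys \<subseteq> K)"

lemma op_closed_op_closure: "op_closed C (op_closure C X)"
  unfolding op_closed_def by (auto intro: op_closure.step)

lemma op_closure_least:
  assumes "X \<subseteq> K" "op_closed C K"
  shows "op_closure C X \<subseteq> K"
proof
  fix x assume "x \<in> op_closure C X"
  then show "x \<in> K"
  proof induction
    case (base x) then show ?case using assms by auto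
  next
    case (step ys x)
    then have "ys \<in> lists K" by auto
    then show ?case using step assms(2) unfolding op_closed_def by blast
  qed
qed

lemma op_closure_mono: "X \<subseteq> Y \<Longrightarrow> op_closure C X \<subseteq> op_closure C Y"
  by (rule op_closure_least[OF _ op_closed_op_closure]) (auto intro: op_closure.base)

lemma card_of_lists_ordLeq_infinite:
  assumes B: "infinite B" and A: "|A| \<le>o |B|"
  shows "|lists A| \<le>o |B|"
proof -
  have len: "|{xs \<in> lists A. length xs = n}| \<le>o |B|" for n
  proof (induction n)
    case 0
    have "{xs \<in> lists A. length xs = 0} = {[]}" by auto
    then show ?case using B by (simp add: card_of_singl_ordLeq infinite_imp_nonempty)
  next
    case (Suc n)
    have "{xs \<in> lists A. length xs = Suc n} = (\<lambda>(x, xs). x # xs) ` (A \<times> {xs \<in> lists A. length xs = n})"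
      by (auto simp: length_Suc_conv image_iff)
    then have "|{xs \<in> lists A. length xs = Suc n}| \<le>o |A \<times> {xs \<in> lists A. length xs = n}|"
      by (simp only: card_of_image)
    also have "|A \<times> {xs \<in> lists A. length xs = n}| \<le>o |B|"
      by (rule card_of_Times_ordLeq_infinite_Field)
         (use B A Suc card_of_Card_order[of B] Field_card_of[of B] in auto)
    finally show ?case .
  qed
  have "lists A = (\<Union>n. {xs \<in> lists A. length xs = n})" by auto
  moreover have "|\<Union>n. {xs \<in> lists A. length xs = n}| \<le>o |B|"
    by (rule card_of_UNION_ordLeq_infinite[OF B]) (use B infinite_iff_card_of_nat len in auto)
  ultimately show ?thesis by simp
qed

text \<open>
  The Loewenheim--Skolem estimate: the closure is reached after \<open>\<omega>\<close> rounds \<open>S n\<close>, and each round adds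
  countably many points for each of the at most \<open>|B|\<close> tuples. The bound is an arbitrary infinite \<open>B\<close>
  rather than \<open>X\<close> itself, so that finite \<open>X\<close> are covered by taking \<open>B\<close> countable.
\<close>
lemma card_of_op_closure:
  fixes B :: "'b set"
  assumes B: "infinite B" and X: "|X| \<le>o |B|" and C: "\<And>ys. countable (C ys)"
  shows "|op_closure C X| \<le>o |B|"
proof -
  define S where "S = rec_nat X (\<lambda>_ Y. Y \<union> (\<Union>ys\<in>lists Y. C ys))"
  have S0: "S 0 = X" and SS: "S (Suc n) = S n \<union> (\<Union>ys\<in>lists (S n). C ys)" for n
    by (simp_all add: S_def)
  have cC: "|C ys| \<le>o |B|" for ys
    using C[of ys] B countable_card_le_natLeq infinite_iff_natLeq_ordLeq ordLeq_transitive by blast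
  have bound: "|S n| \<le>o |B|" for n
  proof (induction n)
    case 0 then show ?case using X S0 by simp
  next
    case (Suc n)
    have "|\<Union>ys\<in>lists (S n). C ys| \<le>o |B|"
      by (rule card_of_UNION_ordLeq_infinite[OF B]) (use card_of_lists_ordLeq_infinite[OF B Suc] cC in auto)
    then show ?case unfolding SS using Suc B card_of_Card_order[of B] Field_card_of[of B] by (intro card_of_Un_ordLeq_infinite_Field) auto
  qed
  have mono: "S m \<subseteq> S n" if "m \<le> n" for m n
    using that by (rule lift_Suc_mono_le[rotated]) (auto simp: SS)
  have fin: "\<exists>n. ys \<in> lists (S n)" if "ys \<in> lists (\<Union>n. S n)" for ys
    using that
  proof (induction ys)
    case (Cons y ys)
    then obtain m n where "y \<in> S m" "ys \<in> lists (S n)" by auto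
    then have "y # ys \<in> lists (S (max m n))"
      using mono[of m "max m n"] mono[of n "max m n"] by auto
    then show ?case ..
  qed auto
  have "op_closed C (\<Union>n. S n)"
    unfolding op_closed_def
  proof
    fix ys assume "ys \<in> lists (\<Union>n. S n)"
    from fin[OF this] obtain n where "ys \<in> lists (S n)" by blast
    then have "C ys \<subseteq> S (Suc n)" unfolding SS by blast
    then show "C ys \<subseteq> (\<Union>n. S n)" by blast
  qed
  then have "op_closure C X \<subseteq> (\<Union>n. S n)"
    by (rule op_closure_least[rotated]) (use S0 in blast)
  then have "|op_closure C X| \<le>o |\<Union>n. S n|" by (rule card_of_mono1)
  also have "|\<Union>n. S n| \<le>o |B|"
    by (rule card_of_UNION_ordLeq_infinite[OF B]) (use B infinite_iff_card_of_nat bound in auto)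
  finally show ?thesis .
qed

text \<open>
  The well-ordering demanded by \<open>Col(G) \<le> \<aleph>\<^sub>0\<close>, relative to a set \<open>K\<close> of vertices; the induction below
  produces it on larger and larger closed sets \<open>K\<close>.
\<close>
definition finite_back_degree :: "'a rel \<Rightarrow> 'a set \<Rightarrow> 'a rel \<Rightarrow> bool" where
  "finite_back_degree E K r \<longleftrightarrow>
     well_order_on K r \<and> (\<forall>x\<in>K. finite {y. (x, y) \<in> E \<and> y \<in> underS r x})"

lemma finite_underS_card_of:
  assumes "countable K" "x \<in> K"
  shows "finite (underS ( |K| ) x)"
proof -
  have "|underS ( |K| ) x| <o |K|"
    using card_of_underS[OF card_of_Card_order, of x K] assms by (simp add: Field_card_of)
  also have "|K| \<le>o natLeq" using assms countable_card_le_natLeq by blast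
  finally show ?thesis using finite_iff_ordLess_natLeq by blast
qed

text \<open>
  Gluing of well-orderings: if every point of \<open>K\<close> has a level \<open>\<rho> z\<close> in a well-ordered set and the points
  of level \<open>i\<close> lie in a well-ordered set \<open>D i\<close>, compare first by level and then inside the level.
  The sets \<open>D i\<close> may overlap; only the points of level exactly \<open>i\<close> are taken from \<open>D i\<close>.
\<close>
lemma well_order_on_levels:
  assumes r: "well_order_on I r"
    and lev: "\<And>z. z \<in> K \<Longrightarrow> \<rho> z \<in> I"
    and s: "\<And>i. i \<in> I \<Longrightarrow> well_order_on (D i) (s i)"
    and D: "\<And>z. z \<in> K \<Longrightarrow> z \<in> D (\<rho> z)"
  shows "well_order_on K {(y, z). y \<in> K \<and> z \<in> K \<and>
           ((\<rho> y, \<rho> z) \<in> r - Id \<or> \<rho> y = \<rho> z \<and> (y, z) \<in> s (\<rho> z))}"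
    (is "well_order_on K ?R")
proof -
  define L where "L = ?R"
  have L: "(y, z) \<in> L \<longleftrightarrow> y \<in> K \<and> z \<in> K \<and>
      ((\<rho> y, \<rho> z) \<in> r - Id \<or> \<rho> y = \<rho> z \<and> (y, z) \<in> s (\<rho> z))" for y z
    unfolding L_def by simp
  have rt: "trans r" and ra: "antisym r" and rto: "total_on I r" and rw: "wf (r - Id)"
    using r unfolding well_order_on_def linear_order_on_def partial_order_on_def preorder_on_def by auto
  have sr: "refl_on (D i) (s i)" and st: "trans (s i)" and sa: "antisym (s i)"
    and sto: "total_on (D i) (s i)" and sw: "wf (s i - Id)" if "i \<in> I" for i
    using s[OF that] unfolding well_order_on_def linear_order_on_def partial_order_on_def preorder_on_def by auto
  have "refl_on K L"
    using sr lev D unfolding refl_on_def L by blast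
  moreover have "L \<subseteq> K \<times> K" by (auto simp: L)
  moreover have "trans L"
  proof (rule transI)
    fix x y z assume xy: "(x, y) \<in> L" and yz: "(y, z) \<in> L"
    have K: "x \<in> K" "z \<in> K" using xy yz unfolding L by blast+
    have strict: "(a, c) \<in> r - Id" if "(a, b) \<in> r - Id" "(b, c) \<in> r - Id" for a b c
      using that rt ra unfolding trans_def antisym_def by blast
    have "(\<rho> x, \<rho> y) \<in> r - Id \<or> \<rho> x = \<rho> y \<and> (x, y) \<in> s (\<rho> y)"
      using xy[unfolded L] by blast
    then have "(\<rho> x, \<rho> z) \<in> r - Id \<or> \<rho> x = \<rho> z \<and> (x, z) \<in> s (\<rho> z)"
    proof (elim disjE)
      assume 1: "(\<rho> x, \<rho> y) \<in> r - Id"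
      have "(\<rho> y, \<rho> z) \<in> r - Id \<or> \<rho> y = \<rho> z" using yz[unfolded L] by blast
      then show ?thesis using strict[OF 1] 1 by auto
    next
      assume 2: "\<rho> x = \<rho> y \<and> (x, y) \<in> s (\<rho> y)"
      have "(\<rho> y, \<rho> z) \<in> r - Id \<or> \<rho> y = \<rho> z \<and> (y, z) \<in> s (\<rho> z)"
        using yz[unfolded L] by blast
      then show ?thesis
      proof (elim disjE)
        assume "(\<rho> y, \<rho> z) \<in> r - Id"
        then show ?thesis using 2 by simp
      next
        assume e: "\<rho> y = \<rho> z \<and> (y, z) \<in> s (\<rho> z)"
        then have "(x, z) \<in> s (\<rho> z)"
          using 2 transD[OF st[OF lev[OF K(2)]], of x y z] by simp
        then show ?thesis using 2 e by simp
      qed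
    qed
    then show "(x, z) \<in> L" using K unfolding L by blast
  qed
  moreover have "antisym L"
  proof (rule antisymI)
    fix x y assume xy: "(x, y) \<in> L" and yx: "(y, x) \<in> L"
    have ne: "\<not> ((a, b) \<in> r - Id \<and> (b, a) \<in> r)" for a b
      using ra unfolding antisym_def by blast
    have "(x, y) \<in> s (\<rho> x)" "(y, x) \<in> s (\<rho> x)"
      using xy yx ne unfolding L by auto
    then show "x = y" using antisymD[OF sa[OF lev]] xy unfolding L by blast
  qed
  moreover have "total_on K L"
    unfolding total_on_def
  proof (intro ballI impI)
    fix x y assume xy: "x \<in> K" "y \<in> K" "x \<noteq> y"
    show "(x, y) \<in> L \<or> (y, x) \<in> L"
    proof (cases "\<rho> x = \<rho> y")
      case True
      then have "(x, y) \<in> s (\<rho> x) \<or> (y, x) \<in> s (\<rho> x)"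
        using sto[OF lev[OF xy(1)]] D[OF xy(1)] D[OF xy(2)] xy(3) unfolding total_on_def by simp
      then show ?thesis using True xy by (auto simp: L)
    next
      case False
      then have "(\<rho> x, \<rho> y) \<in> r \<or> (\<rho> y, \<rho> x) \<in> r"
        using rto lev[OF xy(1)] lev[OF xy(2)] unfolding total_on_def by simp
      then show ?thesis using False xy by (auto simp: L)
    qed
  qed
  moreover have "wf (L - Id)"
    unfolding wf_eq_minimal
  proof (intro allI impI)
    fix Q and q :: 'b assume "q \<in> Q"
    show "\<exists>z\<in>Q. \<forall>y. (y, z) \<in> L - Id \<longrightarrow> y \<notin> Q"
    proof (cases "Q \<inter> K = {}")
      case True
      then have "(y, q) \<notin> L" for y using \<open>q \<in> Q\<close> L by blast
      then show ?thesis using \<open>q \<in> Q\<close> by blast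
    next
      case False
      then obtain z0 where "\<rho> z0 \<in> \<rho> ` (Q \<inter> K)" by blast
      then obtain i where i: "i \<in> \<rho> ` (Q \<inter> K)"
        and imin: "\<And>j. (j, i) \<in> r - Id \<Longrightarrow> j \<notin> \<rho> ` (Q \<inter> K)"
        by (rule wfE_min[OF rw]) blast
      then have "i \<in> I" using lev by auto
      obtain z1 where "z1 \<in> {z \<in> Q \<inter> K. \<rho> z = i}" using i by blast
      then obtain z where z: "z \<in> {z \<in> Q \<inter> K. \<rho> z = i}"
        and zmin: "\<And>y. (y, z) \<in> s i - Id \<Longrightarrow> y \<notin> {z \<in> Q \<inter> K. \<rho> z = i}"
        by (rule wfE_min[OF sw[OF \<open>i \<in> I\<close>]]) blast
      have "y \<notin> Q" if "(y, z) \<in> L - Id" for y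
      proof
        assume "y \<in> Q"
        then have y: "y \<in> Q \<inter> K" and yz: "(\<rho> y, \<rho> z) \<in> r - Id \<or> \<rho> y = \<rho> z \<and> (y, z) \<in> s (\<rho> z)" "y \<noteq> z"
          using that L[of y z] by blast+
        from yz(1) show False
        proof
          assume "(\<rho> y, \<rho> z) \<in> r - Id"
          then show False using imin[of "\<rho> y"] z y by auto
        next
          assume "\<rho> y = \<rho> z \<and> (y, z) \<in> s (\<rho> z)"
          then show False using zmin[of y] z y yz(2) by simp
        qed
      qed
      then show ?thesis using z by blast
    qed
  qed
  ultimately have "well_order_on K L"
    unfolding well_order_on_def linear_order_on_def partial_order_on_def preorder_on_def by blast
  then show ?thesis unfolding L_def .
qed

text \<open>
  The combinatorial core, by induction on the cardinality of a closed set \<open>K\<close>. If \<open>K\<close> is countable, an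
  enumeration of order type at most \<open>\<omega>\<close> works. If \<open>K\<close> is uncountable, well-order it in type \<open>|K|\<close> and let
  \<open>D i\<close> be the closure of the points up to \<open>i\<close>. These sets increase to \<open>K\<close>, are smaller than \<open>K\<close>, and hence
  are well-ordered suitably by induction. Glue these orders along the first level at which a point
  appears. The neighbours of \<open>x\<close> of smaller level lie in a union of an increasing chain of closed sets
  that omits \<open>x\<close>; this union is closed, so they are finitely many. Those of equal level are finitely
  many by the choice of the order on \<open>D (\<rho> x)\<close>.
\<close>
lemma finite_back_degree_closed:
  fixes C :: "'a list \<Rightarrow> 'a set"
  assumes C: "\<And>ys. countable (C ys)"
    and V: "op_closed C V"
    and fin: "\<And>K x. op_closed C K \<Longrightarrow> x \<in> V - K \<Longrightarrow> finite {y \<in> K. (x, y) \<in> E}"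
  shows "\<exists>r. finite_back_degree E V r"
proof -
  have "\<exists>r. finite_back_degree E K r" if "op_closed C K" "K \<subseteq> V" for K
    using that
  proof (induction "|K|" arbitrary: K rule: wf_induct_rule[OF wf_ordLess])
    case (1 K)
    have wo: "well_order_on K |K|" by (rule card_of_well_order_on)
    show ?case
    proof (cases "countable K")
      case True
      then have "finite_back_degree E K |K|"
        unfolding finite_back_degree_def
        by (auto intro: wo finite_subset[OF _ finite_underS_card_of])
      then show ?thesis ..
    next
      case False
      let ?r = "|K|"
      define D where "D i = op_closure C (under ?r i)" for i
      have refl: "(z, z) \<in> ?r" if "z \<in> K" for z
        using wo that unfolding well_order_on_def linear_order_on_def partial_order_on_def preorder_on_def refl_on_def by blast
      have Dself: "z \<in> D z" if "z \<in> K" for z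
        unfolding D_def using refl[OF that] by (auto simp: under_def intro: op_closure.base)
      have rsub: "?r \<subseteq> K \<times> K"
        using wo well_order_on_domain by fastforce
      have DK: "D i \<subseteq> K" for i
        unfolding D_def by (rule op_closure_least[OF _ 1(2)]) (use rsub in \<open>auto simp: under_def\<close>)
      have Dmono: "D i \<subseteq> D j" if "(i, j) \<in> ?r" for i j
      proof -
        have "under ?r i \<subseteq> under ?r j"
          using that wo unfolding under_def well_order_on_def linear_order_on_def partial_order_on_def preorder_on_def trans_def by blast
        then show ?thesis unfolding D_def by (rule op_closure_mono)
      qed
      have Dcl: "op_closed C (D i)" for i
        unfolding D_def by (rule op_closed_op_closure)
      have Dsmall: "|D i| <o |K|" if "i \<in> K" for i
      proof -
        have uS: "|underS ?r i| <o |K|"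
          using card_of_underS[OF card_of_Card_order, of i K] that by (simp add: Field_card_of)
        have natK: "natLeq <o |K|"
          using False countable_card_le_natLeq[of K]
            not_ordLeq_iff_ordLess[OF natLeq_Well_order card_of_Well_order, of K] by simp
        have u: "under ?r i \<subseteq> {i} \<union> underS ?r i"
          unfolding under_def underS_def by auto
        show ?thesis
        proof (cases "finite (underS ?r i)")
          case True
          then have "finite (under ?r i)" using finite_subset[OF u] by simp
          then have "|under ?r i| \<le>o |UNIV :: nat set|"
            using countable_card_of_nat countable_finite by metis
          then have "|D i| \<le>o |UNIV :: nat set|"
            unfolding D_def by (intro card_of_op_closure[OF _ _ C]) auto
          also have "|UNIV :: nat set| =o natLeq" by (rule card_of_nat)
          finally show ?thesis using natK ordLeq_ordLess_trans by blast
        next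
          case False
          have "|{i} \<union> underS ?r i| \<le>o |underS ?r i|"
          proof (rule card_of_Un_ordLeq_infinite_Field)
            show "|{i}| \<le>o |underS ?r i|"
              using False by (intro card_of_singl_ordLeq) auto
          qed (use False card_of_mono1[OF subset_refl] card_of_Card_order[of "underS ?r i"] in \<open>auto simp: Field_card_of\<close>)
          then have "|under ?r i| \<le>o |underS ?r i|"
            by (rule ordLeq_transitive[OF card_of_mono1[OF u]])
          then have "|D i| \<le>o |underS ?r i|"
            unfolding D_def by (rule card_of_op_closure[OF False _ C])
          then show ?thesis using uS ordLeq_ordLess_trans by blast
        qed
      qed
      have "\<exists>s. finite_back_degree E (D i) s" if "i \<in> K" for i
        using 1(1)[OF Dsmall[OF that] Dcl] DK[of i] 1(3) by blast
      then obtain s where s: "\<And>i. i \<in> K \<Longrightarrow> finite_back_degree E (D i) (s i)" by metis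
      have "\<exists>i. i \<in> K \<and> z \<in> D i \<and> (\<forall>j. (j, i) \<in> ?r - Id \<longrightarrow> z \<notin> D j)" if "z \<in> K" for z
      proof -
        have w: "wf (?r - Id)" using wo unfolding well_order_on_def by blast
        have "z \<in> {i \<in> K. z \<in> D i}" using that Dself by simp
        then obtain i where i: "i \<in> {i \<in> K. z \<in> D i}"
          and imin: "\<And>j. (j, i) \<in> ?r - Id \<Longrightarrow> j \<notin> {i \<in> K. z \<in> D i}"
          by (rule wfE_min[OF w]) blast
        have "z \<notin> D j" if "(j, i) \<in> ?r - Id" for j
          using imin[OF that] that rsub by auto
        then show ?thesis using i by auto
      qed
      then obtain \<rho> where \<rho>K: "\<And>z. z \<in> K \<Longrightarrow> \<rho> z \<in> K" and \<rho>D: "\<And>z. z \<in> K \<Longrightarrow> z \<in> D (\<rho> z)"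
        and \<rho>min: "\<And>z j. z \<in> K \<Longrightarrow> (j, \<rho> z) \<in> ?r - Id \<Longrightarrow> z \<notin> D j" by metis
      let ?L = "{(y, z). y \<in> K \<and> z \<in> K \<and>
           ((\<rho> y, \<rho> z) \<in> ?r - Id \<or> \<rho> y = \<rho> z \<and> (y, z) \<in> s (\<rho> z))}"
      have "well_order_on (D i) (s i)" if "i \<in> K" for i
        using s[OF that] unfolding finite_back_degree_def by simp
      note L = well_order_on_levels[where D = D, OF wo \<rho>K this \<rho>D]
      have "finite {y. (x, y) \<in> E \<and> y \<in> underS ?L x}" if x: "x \<in> K" for x
      proof -
        define U where "U = (\<Union>j\<in>underS ?r (\<rho> x). D j)"
        \<comment> \<open>A tuple from an increasing union already lies in one member; the empty tuple is excluded
          because the union may be empty, when \<open>\<rho> x\<close> is the least level.\<close>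
        have chain: "\<exists>j\<in>underS ?r (\<rho> x). set ys \<subseteq> D j" if "ys \<in> lists U" "ys \<noteq> []" for ys
          using that
        proof (induction ys)
          case (Cons y ys)
          then obtain j where j: "j \<in> underS ?r (\<rho> x)" "y \<in> D j" unfolding U_def by auto
          show ?case
          proof (cases "ys = []")
            case True then show ?thesis using j by auto
          next
            case False
            then obtain k where k: "k \<in> underS ?r (\<rho> x)" "set ys \<subseteq> D k" using Cons by auto
            have "j \<in> K" "k \<in> K" using j(1) k(1) rsub by (auto simp: underS_def)
            then have "(j, k) \<in> ?r \<or> (k, j) \<in> ?r"
              using wo refl[of j] unfolding well_order_on_def linear_order_on_def total_on_def by (cases "j = k") auto
            then show ?thesis
            using Dmono[of j k] Dmono[of k j] j k by auto
          qed
        qed simp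
        have "finite {y \<in> U. (x, y) \<in> E}"
        proof (cases "underS ?r (\<rho> x) = {}")
          case True then show ?thesis unfolding U_def by simp
        next
          case False
          have "op_closed C U"
            unfolding op_closed_def
          proof
            fix ys assume ys: "ys \<in> lists U"
            have "\<exists>j\<in>underS ?r (\<rho> x). set ys \<subseteq> D j"
              using chain[OF ys] False by (cases "ys = []") auto
            then obtain j where j: "j \<in> underS ?r (\<rho> x)" "ys \<in> lists (D j)" by auto
            then show "C ys \<subseteq> U" using Dcl[of j] unfolding op_closed_def U_def by blast
          qed
          moreover have "x \<notin> U" using \<rho>min[OF x] unfolding U_def underS_def by auto
          ultimately show ?thesis using fin x 1(3) by blast
        qed
        moreover have "finite {y. (x, y) \<in> E \<and> y \<in> underS (s (\<rho> x)) x}"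
          using s[OF \<rho>K[OF x]] \<rho>D[OF x] unfolding finite_back_degree_def by blast
        moreover have "{y. (x, y) \<in> E \<and> y \<in> underS ?L x} \<subseteq>
            {y \<in> U. (x, y) \<in> E} \<union> {y. (x, y) \<in> E \<and> y \<in> underS (s (\<rho> x)) x}"
          unfolding U_def underS_def using \<rho>D by auto
        ultimately show ?thesis using finite_subset by blast
      qed
      then show ?thesis using L unfolding finite_back_degree_def by blast
    qed
  qed
  then show ?thesis using V by blast
qed

section \<open>Hilbert's basis theorem for polynomial functions\<close>

text \<open>
  The ideal of \<open>R\<close> generated by \<open>S\<close>, for a subring \<open>R\<close> given as a subset of a ring type. An inductive
  definition makes the finite character of ideals available as an induction rule.
\<close>
inductive_set ideal_gen :: "'r::comm_ring_1 set \<Rightarrow> 'r set \<Rightarrow> 'r set"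
  for R S :: "'r set" where
  zero: "0 \<in> ideal_gen R S"
| add: "x \<in> ideal_gen R S \<Longrightarrow> r \<in> R \<Longrightarrow> s \<in> S \<Longrightarrow> x + r * s \<in> ideal_gen R S"

definition is_subring :: "'r::comm_ring_1 set \<Rightarrow> bool" where
  "is_subring R \<longleftrightarrow> 0 \<in> R \<and> 1 \<in> R \<and> (\<forall>x\<in>R. \<forall>y\<in>R. x - y \<in> R \<and> x * y \<in> R)"

text \<open>
  The ascending chain condition in the form in which it is used: no sequence leaves, at every step,
  the ideal generated by its earlier members.
\<close>
definition noetherian :: "'r::comm_ring_1 set \<Rightarrow> bool" where
  "noetherian R \<longleftrightarrow> (\<forall>a :: nat \<Rightarrow> 'r. range a \<subseteq> R \<longrightarrow> (\<exists>m. a m \<in> ideal_gen R (a ` {..<m})))"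

text \<open>
  The ring \<open>R[t]\<close>. The element \<open>t\<close> may be algebraic over \<open>R\<close>, so a member can come from many polynomials.
\<close>
definition adjoin :: "'r::comm_ring_1 set \<Rightarrow> 'r \<Rightarrow> 'r set" where
  "adjoin R t = {poly p t | p. \<forall>i. coeff p i \<in> R}"

lemma is_subringD:
  assumes "is_subring R"
  shows "0 \<in> R" "1 \<in> R" "x \<in> R \<Longrightarrow> y \<in> R \<Longrightarrow> x - y \<in> R" "x \<in> R \<Longrightarrow> y \<in> R \<Longrightarrow> x * y \<in> R"
    "x \<in> R \<Longrightarrow> - x \<in> R" "x \<in> R \<Longrightarrow> y \<in> R \<Longrightarrow> x + y \<in> R"
proof -
  show 1: "0 \<in> R" "1 \<in> R" and 2: "\<And>x y. x \<in> R \<Longrightarrow> y \<in> R \<Longrightarrow> x - y \<in> R"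
    and "x \<in> R \<Longrightarrow> y \<in> R \<Longrightarrow> x * y \<in> R"
    using assms unfolding is_subring_def by auto
  show 3: "- x \<in> R" if "x \<in> R" for x using 2[OF 1(1) that] by simp
  show "x \<in> R \<Longrightarrow> y \<in> R \<Longrightarrow> x + y \<in> R" using 2[of x "- y"] 3[of y] by simp
qed

lemma is_subring_sum: "is_subring R \<Longrightarrow> (\<And>i. i \<in> A \<Longrightarrow> f i \<in> R) \<Longrightarrow> sum f A \<in> R"
  by (induction A rule: infinite_finite_induct) (auto simp: is_subringD)

lemma is_subring_prod: "is_subring R \<Longrightarrow> (\<And>i. i \<in> A \<Longrightarrow> f i \<in> R) \<Longrightarrow> prod f A \<in> R"
  by (induction A rule: infinite_finite_induct) (auto simp: is_subringD)

lemma is_subring_power: "is_subring R \<Longrightarrow> x \<in> R \<Longrightarrow> x ^ n \<in> R"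
  by (induction n) (auto simp: is_subringD)

lemma ideal_gen_base: "is_subring R \<Longrightarrow> s \<in> S \<Longrightarrow> s \<in> ideal_gen R S"
  using ideal_gen.add[OF ideal_gen.zero, of 1 R s S] by (simp add: is_subringD)

lemma ideal_gen_plus:
  assumes "y \<in> ideal_gen R S" and x: "x \<in> ideal_gen R S"
  shows "x + y \<in> ideal_gen R S"
  using assms(1)
proof induction
  case zero then show ?case using x by simp
next
  case (add y r s)
  then have "(x + y) + r * s \<in> ideal_gen R S" by (intro ideal_gen.add)
  then show ?case by (simp add: add.assoc)
qed

lemma ideal_gen_mult:
  assumes "x \<in> ideal_gen R S" and R: "is_subring R" "r \<in> R"
  shows "r * x \<in> ideal_gen R S"
  using assms(1)
proof induction
  case zero then show ?case by (simp add: ideal_gen.zero)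
next
  case (add x r' s)
  then have "r * x + (r * r') * s \<in> ideal_gen R S" using R by (intro ideal_gen.add) (auto simp: is_subringD)
  then show ?case by (simp add: algebra_simps)
qed

lemma ideal_gen_subset:
  assumes R: "is_subring R" and S: "S \<subseteq> ideal_gen R T"
  shows "ideal_gen R S \<subseteq> ideal_gen R T"
proof
  fix x assume "x \<in> ideal_gen R S"
  then show "x \<in> ideal_gen R T"
  proof induction
    case zero show ?case by (rule ideal_gen.zero)
  next
    case (add x r s)
    then have "r * s \<in> ideal_gen R T" using R S ideal_gen_mult by blast
    then show ?case using add ideal_gen_plus by blast
  qed
qed

lemma ideal_gen_mono:
  assumes "is_subring R" "S \<subseteq> T" shows "ideal_gen R S \<subseteq> ideal_gen R T"
  using assms by (intro ideal_gen_subset) (auto intro: ideal_gen_base)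

lemma ideal_gen_range:
  fixes a :: "nat \<Rightarrow> 'r::comm_ring_1"
  assumes "x \<in> ideal_gen R (range a)" and R: "is_subring R"
  shows "\<exists>m. x \<in> ideal_gen R (a ` {..<m})"
  using assms(1)
proof induction
  case zero show ?case by (blast intro: ideal_gen.zero)
next
  case (add x r s)
  then obtain m n where m: "x \<in> ideal_gen R (a ` {..<m})" and n: "s = a n" by blast
  have "x \<in> ideal_gen R (a ` {..<max m (Suc n)})"
    using m ideal_gen_mono[OF R image_mono[of "{..<m}" "{..<max m (Suc n)}" a]] by auto
  then have "x + r * s \<in> ideal_gen R (a ` {..<max m (Suc n)})"
    using add(2) n by (intro ideal_gen.add) auto
  then show ?case ..
qed

text \<open>
  Dependent choice, where each new member is chosen in view of the set of all earlier ones.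
\<close>
lemma dependent_sequence:
  assumes "\<And>F. finite F \<Longrightarrow> F \<subseteq> A \<Longrightarrow> \<exists>x. x \<in> A \<and> P F x"
  shows "\<exists>f :: nat \<Rightarrow> 'a. \<forall>m. f m \<in> A \<and> P (f ` {..<m}) (f m)"
proof (rule dependent_wf_choice[OF wf_less_than])
  fix f g :: "nat \<Rightarrow> 'a" and m r assume *: "\<And>z. (z, m) \<in> less_than \<Longrightarrow> f z = g z"
  have "f ` {..<m} = g ` {..<m}" by (rule image_cong) (use * in auto)
  then show "(r \<in> A \<and> P (f ` {..<m}) r) = (r \<in> A \<and> P (g ` {..<m}) r)" by simp
next
  fix m and f :: "nat \<Rightarrow> 'a"
  assume "\<And>y. (y, m) \<in> less_than \<Longrightarrow> f y \<in> A \<and> P (f ` {..<y}) (f y)"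
  then show "\<exists>r. r \<in> A \<and> P (f ` {..<m}) r" by (intro assms) auto
qed

lemma is_subring_adjoin:
  assumes R: "is_subring R" shows "is_subring (adjoin R t)"
  unfolding is_subring_def
proof (intro conjI ballI)
  show "0 \<in> adjoin R t" unfolding adjoin_def
    by (rule CollectI, rule exI[of _ 0]) (use R in \<open>auto simp: is_subringD\<close>)
  show "1 \<in> adjoin R t" unfolding adjoin_def
    by (rule CollectI, rule exI[of _ 1]) (use R in \<open>auto simp: is_subringD coeff_1\<close>)
  fix x y assume "x \<in> adjoin R t" "y \<in> adjoin R t"
  then obtain p q where pq: "x = poly p t" "y = poly q t" "\<And>i. coeff p i \<in> R" "\<And>i. coeff q i \<in> R"
    unfolding adjoin_def by auto
  show "x - y \<in> adjoin R t" unfolding adjoin_def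
    by (rule CollectI, rule exI[of _ "p - q"]) (use R pq in \<open>auto simp: is_subringD\<close>)
  show "x * y \<in> adjoin R t" unfolding adjoin_def
    by (rule CollectI, rule exI[of _ "p * q"]) (use R pq in \<open>auto simp: is_subringD coeff_mult intro!: is_subring_sum\<close>)
qed

lemma subset_adjoin:
  assumes R: "is_subring R" shows "R \<subseteq> adjoin R t"
proof
  fix r assume "r \<in> R"
  then show "r \<in> adjoin R t" unfolding adjoin_def
    by (intro CollectI exI[of _ "[:r:]"]) (use R in \<open>auto simp: is_subringD coeff_pCons split: nat.splits\<close>)
qed

lemma generator_in_adjoin:
  assumes R: "is_subring R" shows "t \<in> adjoin R t"
  unfolding adjoin_def
  by (intro CollectI exI[of _ "[:0, 1:]"]) (use R in \<open>auto simp: is_subringD coeff_pCons split: nat.splits\<close>)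

text \<open>
  Hilbert's basis theorem. Suppose a sequence \<open>b\<close> in \<open>R[t]\<close> leaves the ideal of its earlier members at
  every step, and let \<open>I\<close> be the ideal of all \<open>b\<close>. No finite subset of \<open>I\<close> generates \<open>I\<close>, so one can choose
  polynomials \<open>f 0, f 1, \<dots>\<close> with values in \<open>I\<close>, each of least degree among those whose value is outside
  the ideal of the earlier values. The degrees then increase weakly. As \<open>R\<close> is noetherian, some leading
  coefficient of \<open>f m\<close> is a combination of earlier ones; multiplying the earlier polynomials by powers
  of the variable gives \<open>q\<close> in their ideal with the same leading term as \<open>f m\<close>, and \<open>f m - q\<close>
  contradicts the minimality of the degree.
\<close>
lemma noetherian_adjoin:
  assumes R: "is_subring R" and N: "noetherian R"
  shows "noetherian (adjoin R t)"
  unfolding noetherian_def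
proof (intro allI impI, rule ccontr)
  let ?A = "adjoin R t"
  have A: "is_subring ?A" by (rule is_subring_adjoin[OF R])
  fix b :: "nat \<Rightarrow> 'a" assume b: "range b \<subseteq> ?A" and no: "\<nexists>m. b m \<in> ideal_gen ?A (b ` {..<m})"
  let ?I = "ideal_gen ?A (range b)"
  define X where "X = {p. (\<forall>i. coeff p i \<in> R) \<and> poly p t \<in> ?I}"
  let ?ev = "\<lambda>p. poly p t"
  define P where "P F p \<longleftrightarrow> p \<in> X \<and> ?ev p \<notin> ideal_gen ?A (?ev ` F)" for F p
  have ex: "\<exists>p. P F p" if F: "finite F" "F \<subseteq> X" for F
  proof -
    have "\<exists>m. ?ev ` F \<subseteq> ideal_gen ?A (b ` {..<m})"
      using F
    proof (induction F rule: finite_induct)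
      case (insert p F)
      then obtain m where m: "?ev ` F \<subseteq> ideal_gen ?A (b ` {..<m})" by auto
      have "?ev p \<in> ?I" using insert.prems unfolding X_def by simp
      from ideal_gen_range[OF this A] obtain n where n: "?ev p \<in> ideal_gen ?A (b ` {..<n})" ..
      have "ideal_gen ?A (b ` {..<k}) \<subseteq> ideal_gen ?A (b ` {..<max m n})" if "k \<le> max m n" for k
        by (rule ideal_gen_mono[OF A image_mono]) (use that in auto)
      from this[of m] this[of n] show ?case using m n by (intro exI[of _ "max m n"]) auto
    qed auto
    then obtain m where m: "?ev ` F \<subseteq> ideal_gen ?A (b ` {..<m})" by blast
    obtain p where p: "\<And>i. coeff p i \<in> R" "b m = ?ev p"
      using b unfolding adjoin_def by blast
    have "b m \<in> ?I" by (rule ideal_gen_base[OF A]) simp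
    moreover have "b m \<notin> ideal_gen ?A (?ev ` F)"
      using ideal_gen_subset[OF A m] no by blast
    ultimately have "P F p" using p unfolding P_def X_def by simp
    then show ?thesis ..
  qed
  have step: "\<exists>p. p \<in> X \<and> (P F p \<and> (\<forall>q. P F q \<longrightarrow> degree p \<le> degree q))" if F: "finite F" "F \<subseteq> X" for F
  proof -
    from ex[OF F] obtain p0 where "P F p0" ..
    from ex_has_least_nat[of "P F", OF this, of degree] show ?thesis unfolding P_def by blast
  qed
  have "\<exists>f :: nat \<Rightarrow> 'a poly. \<forall>m. f m \<in> X \<and> (P (f ` {..<m}) (f m) \<and>
      (\<forall>q. P (f ` {..<m}) q \<longrightarrow> degree (f m) \<le> degree q))"
    by (rule dependent_sequence, rule step)
  then obtain f :: "nat \<Rightarrow> 'a poly" where f: "\<forall>m. f m \<in> X \<and> (P (f ` {..<m}) (f m) \<and>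
      (\<forall>q. P (f ` {..<m}) q \<longrightarrow> degree (f m) \<le> degree q))" ..
  have fX: "f m \<in> X" and fP: "P (f ` {..<m}) (f m)"
    and fmin: "P (f ` {..<m}) q \<Longrightarrow> degree (f m) \<le> degree q" for m q
    using f by simp_all
  define d where "d m = degree (f m)" for m
  have dmono: "d i \<le> d m" if "i \<le> m" for i m
  proof -
    have "?ev ` f ` {..<i} \<subseteq> ?ev ` f ` {..<m}" using that by auto
    then have "P (f ` {..<i}) (f m)"
      using fP[of m] ideal_gen_mono[OF A] unfolding P_def by blast
    then show ?thesis unfolding d_def by (rule fmin)
  qed
  let ?lc = "\<lambda>m. lead_coeff (f m)"
  have "range ?lc \<subseteq> R" using fX unfolding X_def by auto
  then obtain m where m: "?lc m \<in> ideal_gen R (?lc ` {..<m})"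
    using N unfolding noetherian_def by blast
  have "\<exists>q. (\<forall>i. coeff q i \<in> R) \<and> ?ev q \<in> ideal_gen ?A (?ev ` f ` {..<m}) \<and>
           degree q \<le> d m \<and> coeff q (d m) = c" if "c \<in> ideal_gen R (?lc ` {..<m})" for c
    using that
  proof induction
    case zero
    show ?case using R by (intro exI[of _ 0]) (auto simp: is_subringD ideal_gen.zero)
  next
    case (add c r s)
    then obtain q i where q: "\<And>i. coeff q i \<in> R" "?ev q \<in> ideal_gen ?A (?ev ` f ` {..<m})"
        "degree q \<le> d m" "coeff q (d m) = c" and i: "i < m" "s = ?lc i" by auto
    let ?u = "monom r (d m - d i)"
    have le: "d i \<le> d m" using dmono i by simp
    have u: "\<And>j. coeff ?u j \<in> R" using R add(2) by (simp add: is_subringD)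
    then have uA: "?ev ?u \<in> ?A" unfolding adjoin_def by blast
    have "?ev q + ?ev ?u * ?ev (f i) \<in> ideal_gen ?A (?ev ` f ` {..<m})"
      by (rule ideal_gen.add[OF q(2) uA]) (use i in auto)
    moreover have "degree (q + ?u * f i) \<le> d m"
    proof (rule degree_add_le[OF q(3)])
      have "degree (?u * f i) \<le> degree ?u + degree (f i)" by (rule degree_mult_le)
      also have "\<dots> \<le> d m" using degree_monom_le[of r "d m - d i"] le unfolding d_def by linarith
      finally show "degree (?u * f i) \<le> d m" .
    qed
    moreover have "coeff (q + ?u * f i) (d m) = c + r * s"
      using q(4) i le by (simp add: coeff_monom_mult d_def)
    moreover have "coeff (q + ?u * f i) j \<in> R" for j
      using R q(1) u fX[of i] unfolding X_def
      by (auto simp: coeff_mult intro!: is_subring_sum is_subringD)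
    ultimately show ?case by (intro exI[of _ "q + ?u * f i"]) simp
  qed
  from this[OF m] obtain q where q: "\<And>i. coeff q i \<in> R" "?ev q \<in> ideal_gen ?A (?ev ` f ` {..<m})"
        "degree q \<le> d m" "coeff q (d m) = ?lc m" by blast
  let ?p = "f m - q"
  have qI: "?ev q \<in> ?I"
    using q(2) ideal_gen_subset[OF A, of "?ev ` f ` {..<m}" "range b"] fX unfolding X_def by blast
  have neg: "- 1 \<in> ?A" using A by (simp add: is_subringD)
  have diff: "x - y \<in> ideal_gen ?A S" if "x \<in> ideal_gen ?A S" "y \<in> ideal_gen ?A S" for x y S
    using ideal_gen_plus[OF ideal_gen_mult[OF that(2) A neg] that(1)] by simp
  have "?ev ?p \<in> ?I" using fX[of m] qI diff unfolding X_def by simp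
  moreover have "coeff ?p i \<in> R" for i using fX[of m] q(1) R unfolding X_def by (simp add: is_subringD)
  moreover have notin: "?ev ?p \<notin> ideal_gen ?A (?ev ` f ` {..<m})"
  proof
    assume "?ev ?p \<in> ideal_gen ?A (?ev ` f ` {..<m})"
    from ideal_gen_plus[OF this q(2)] have "?ev (f m) \<in> ideal_gen ?A (?ev ` f ` {..<m})" by simp
    then show False using fP[of m] unfolding P_def by blast
  qed
  ultimately have "P (f ` {..<m}) ?p" unfolding P_def X_def by blast
  from fmin[OF this] have "d m \<le> degree ?p" unfolding d_def .
  moreover have "degree ?p \<le> d m" using q(3) by (intro degree_diff_le) (auto simp: d_def)
  moreover have "coeff ?p (d m) = 0" using q(4) by (simp add: d_def)
  ultimately have "?p = 0" by (metis leading_coeff_0_iff le_antisym)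
  then have "?ev ?p = 0" by simp
  then show False using notin ideal_gen.zero[of ?A] by simp
qed

text \<open>
  The ring \<open>\<real>[x\<^sub>0, \<dots>, x\<^sub>n\<^sub>-\<^sub>1]\<close> of polynomial functions, built by adjoining one coordinate at a time so
  that the basis theorem applies. The functions live on \<open>\<real>\<^sup>\<nat>\<close>, which keeps all \<open>n\<close> in one type and
  makes the domain a Polish space.
\<close>
primrec poly_fun :: "nat \<Rightarrow> ((nat \<Rightarrow> real) \<Rightarrow> real) set" where
  "poly_fun 0 = range (\<lambda>c _. c)"
| "poly_fun (Suc n) = adjoin (poly_fun n) (\<lambda>u. u n)"

lemma is_subring_poly_fun: "is_subring (poly_fun n)"
proof (induction n)
  case 0
  show ?case unfolding is_subring_def by (auto simp: image_iff zero_fun_def one_fun_def fun_eq_iff)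
next
  case (Suc n) then show ?case by (simp add: is_subring_adjoin)
qed

lemma noetherian_poly_fun: "noetherian (poly_fun n)"
proof (induction n)
  case 0
  show ?case unfolding noetherian_def
  proof (intro allI impI)
    fix a :: "nat \<Rightarrow> (nat \<Rightarrow> real) \<Rightarrow> real" assume "range a \<subseteq> poly_fun 0"
    then have "\<forall>m. \<exists>c. a m = (\<lambda>_. c)" by (auto simp: image_iff)
    then obtain c where c: "\<And>m. a m = (\<lambda>_. c m)" by metis
    show "\<exists>m. a m \<in> ideal_gen (poly_fun 0) (a ` {..<m})"
    proof (cases "c 0 = 0")
      case True
      then have "a 0 = 0" using c by (simp add: zero_fun_def)
      then have "a 0 \<in> ideal_gen (poly_fun 0) (a ` {..<0})" by (simp add: ideal_gen.zero)
      then show ?thesis ..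
    next
      case False
      have "0 + (\<lambda>_. c 1 / c 0) * a 0 \<in> ideal_gen (poly_fun 0) (a ` {..<1})"
        by (intro ideal_gen.add ideal_gen.zero) auto
      moreover have "0 + (\<lambda>_. c 1 / c 0) * a 0 = a 1" using c False by (simp add: fun_eq_iff)
      ultimately show ?thesis by (intro exI[of _ 1]) simp
    qed
  qed
next
  case (Suc n) then show ?case by (simp add: noetherian_adjoin is_subring_poly_fun)
qed

lemma const_poly_fun: "(\<lambda>_. c) \<in> poly_fun n"
proof (induction n)
  case (Suc n) then show ?case using subset_adjoin[OF is_subring_poly_fun] by auto
qed auto

lemma coord_poly_fun: "i < n \<Longrightarrow> (\<lambda>u. u i) \<in> poly_fun n"
proof (induction n)
  case (Suc n)
  then show ?case
    using subset_adjoin[OF is_subring_poly_fun] generator_in_adjoin[OF is_subring_poly_fun]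
    by (cases "i = n") auto
qed auto

lemma continuous_poly_fun: "h \<in> poly_fun n \<Longrightarrow> continuous_on UNIV h"
proof (induction n arbitrary: h)
  case 0 then show ?case by auto
next
  case (Suc n)
  then obtain p where h: "h = poly p (\<lambda>u. u n)" and p: "\<And>i. coeff p i \<in> poly_fun n"
    by (auto simp: adjoin_def)
  have "continuous_on UNIV (poly p (\<lambda>u. u n))" using p
  proof (induction p)
    case 0 then show ?case by (simp add: zero_fun_def)
  next
    case (pCons a p)
    have "a \<in> poly_fun n" using pCons(3)[of 0] by simp
    then have a: "continuous_on UNIV a" by (rule Suc.IH)
    have "coeff p i \<in> poly_fun n" for i using pCons(3)[of "Suc i"] by simp
    then have p: "continuous_on UNIV (poly p (\<lambda>u. u n))" by (rule pCons)
    have "continuous_on UNIV (\<lambda>u. a u + u n * poly p (\<lambda>u. u n) u)"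
      by (intro continuous_on_add continuous_on_mult a p continuous_on_product_coordinates)
    then show ?case by (simp add: plus_fun_def times_fun_def)
  qed
  then show ?case using h by simp
qed

lemma ideal_gen_zeros:
  fixes u :: 'b and R :: "('b \<Rightarrow> real) set"
  assumes "h \<in> ideal_gen R S" "\<And>s. s \<in> S \<Longrightarrow> s u = 0"
  shows "h u = 0"
  using assms(1) by induction (auto simp: assms(2))

text \<open>
  A system of polynomial equations, however large, is equivalent to a finite part of it. Otherwise
  one could keep choosing equations that are violated at some common zero of the earlier ones, but by
  the noetherian property one of them would lie in the ideal of its predecessors.
\<close>
lemma finite_subsystem:
  assumes H: "H \<subseteq> poly_fun n"
  shows "\<exists>F\<subseteq>H. finite F \<and> (\<forall>u. (\<forall>h\<in>F. h u = 0) \<longrightarrow> (\<forall>h\<in>H. h u = 0))"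
proof (rule ccontr)
  assume "\<not> ?thesis"
  then have step: "\<exists>h. h \<in> H \<and> (\<exists>u. (\<forall>g\<in>F. g u = 0) \<and> h u \<noteq> 0)" if "finite F" "F \<subseteq> H" for F
    using that by blast
  have "\<exists>f :: nat \<Rightarrow> (nat \<Rightarrow> real) \<Rightarrow> real. \<forall>m. f m \<in> H \<and> (\<exists>u. (\<forall>g\<in>f ` {..<m}. g u = 0) \<and> f m u \<noteq> 0)"
    by (rule dependent_sequence, rule step)
  then obtain f :: "nat \<Rightarrow> (nat \<Rightarrow> real) \<Rightarrow> real"
    where f: "\<forall>m. f m \<in> H \<and> (\<exists>u. (\<forall>g\<in>f ` {..<m}. g u = 0) \<and> f m u \<noteq> 0)" ..
  then have "range f \<subseteq> poly_fun n" using H by auto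
  then obtain m where "f m \<in> ideal_gen (poly_fun n) (f ` {..<m})"
    using noetherian_poly_fun[of n] unfolding noetherian_def by blast
  moreover obtain u where "\<forall>g\<in>f ` {..<m}. g u = 0" "f m u \<noteq> 0" using f by blast
  ultimately show False using ideal_gen_zeros[of "f m" _ "f ` {..<m}" u] by blast
qed

section \<open>Uncountable closed sets\<close>

text \<open>
  The Cantor--Bendixson argument: deleting from \<open>S\<close> all its countable basic pieces removes countably many
  points in total and leaves a nonempty perfect set, which has the cardinality of the continuum.
\<close>
lemma uncountable_closed_lepoll:
  fixes S :: "'a::polish_space set"
  assumes "closed S" "uncountable S"
  shows "(UNIV :: real set) \<lesssim> S"
proof -
  obtain \<B> :: "'a set set" where cB: "countable \<B>" and B: "topological_basis \<B>"
    using ex_countable_basis by blast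
  define N where "N = (\<Union>U\<in>{U \<in> \<B>. countable (U \<inter> S)}. U \<inter> S)"
  define P where "P = S - N"
  have N: "countable N" unfolding N_def using cB by (intro countable_UN) auto
  have nbhd: "uncountable (U \<inter> S)" if U: "open U" "x \<in> U" "x \<in> P" for U x
  proof
    assume c: "countable (U \<inter> S)"
    obtain W where "W \<in> \<B>" "x \<in> W" "W \<subseteq> U" using topological_basisE[OF B U(1,2)] by blast
    moreover have "countable (W \<inter> S)" by (rule countable_subset[OF _ c]) (use \<open>W \<subseteq> U\<close> in blast)
    ultimately show False using U(3) unfolding P_def N_def by blast
  qed
  have limpt: "x islimpt P" if "x \<in> P" for x
    unfolding islimpt_def
  proof (intro allI impI)
    fix U assume "x \<in> U" "open U"
    then have "uncountable (U \<inter> S - insert x N)"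
      using nbhd[OF _ _ that] N by (intro uncountable_minus_countable) auto
    then have "U \<inter> S - insert x N \<noteq> {}" by (metis countable_empty)
    then obtain y where "y \<in> U \<inter> S - insert x N" by blast
    then show "\<exists>y\<in>P. y \<in> U \<and> y \<noteq> x" unfolding P_def by blast
  qed
  have "P = S \<inter> - \<Union>{U \<in> \<B>. countable (U \<inter> S)}" unfolding P_def N_def by blast
  moreover have "open (\<Union>{U \<in> \<B>. countable (U \<inter> S)})" 
    using topological_basis_open[OF B] by (intro open_Union) auto
  ultimately have "closed P" using assms(1) by (simp add: closed_Int closed_Compl)
  then have "x islimpt P \<longleftrightarrow> x \<in> P" for x using limpt closed_limpt[of P] by blast
  moreover have "x \<in> euclidean derived_set_of P \<longleftrightarrow> x islimpt P" for x
    unfolding in_derived_set_of islimpt_def open_openin[symmetric] topspace_euclidean by blast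
  ultimately have perfect: "euclidean derived_set_of P = P" by blast
  have "P \<noteq> {}" using uncountable_minus_countable[OF assms(2) N] unfolding P_def
    by (metis countable_empty)
  moreover have "completely_metrizable_space (euclidean :: 'a topology)"
    by (metis Met_TC.completely_metrizable_space_mtopology complete_UNIV mcomplete_iff_complete mtopology_is_euclidean)
  ultimately have "(UNIV :: real set) \<lesssim> P" using lepoll_perfect_set[of euclidean P] perfect by blast
  also have "P \<lesssim> S" by (rule subset_imp_lepoll) (simp add: P_def)
  finally show ?thesis .
qed

section \<open>Algebraic sets in sequence space\<close>

text \<open>
  Embeds each \<open>\<real>\<^sup>n\<close> as a closed subspace of \<open>\<real>\<^sup>\<nat>\<close>.
\<close>
definition zero_extend :: "real list \<Rightarrow> nat \<Rightarrow> real" where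
  "zero_extend x i = (if i < length x then x ! i else 0)"

lemma sum_fun_apply: "(\<Sum>i\<in>A. f i) x = (\<Sum>i\<in>A. f i x)"
  for f :: "'i \<Rightarrow> 'b \<Rightarrow> real"
  by (induction A rule: infinite_finite_induct) (auto simp: zero_fun_def plus_fun_def)

lemma prod_fun_apply: "(\<Prod>i\<in>A. f i) x = (\<Prod>i\<in>A. f i x)"
  for f :: "'i \<Rightarrow> 'b \<Rightarrow> real"
  by (induction A rule: infinite_finite_induct) (auto simp: one_fun_def times_fun_def)

lemma power_fun_apply: "(f ^ k) x = f x ^ k" for f :: "'b \<Rightarrow> real"
  by (induction k) (auto simp: one_fun_def times_fun_def)

text \<open>
  Fixing the last coordinates of a polynomial leaves a polynomial in the first ones. With \<open>y = []\<close> this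
  describes algebraic sets themselves, with \<open>y\<close> a vertex the set of points joined to \<open>y\<close> by one algebraic
  piece of the edge relation.
\<close>
lemma algebraic_section:
  assumes B: "algebraic_set (n + length y) B"
  shows "\<exists>h\<in>poly_fun n. \<forall>x. length x = n \<longrightarrow> (h (zero_extend x) = 0 \<longleftrightarrow> x @ y \<in> B)"
proof -
  obtain p where p: "mpoly_vars p \<subseteq> {..<n + length y}"
    and Bp: "B = {x. length x = n + length y \<and> mpoly_eval p x = 0}"
    using B unfolding algebraic_set_def by blast
  define v :: "nat \<Rightarrow> (nat \<Rightarrow> real) \<Rightarrow> real" where
    "v i = (if i < n then (\<lambda>u. u i) else (\<lambda>_. y ! (i - n)))" for i
  define h where "h = (\<Sum>m\<in>Poly_Mapping.keys p. (\<lambda>_. Poly_Mapping.lookup p m) *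
        (\<Prod>i\<in>Poly_Mapping.keys m. v i ^ Poly_Mapping.lookup m i))"
  have "v i \<in> poly_fun n" for i
    unfolding v_def by (simp add: coord_poly_fun const_poly_fun)
  then have "h \<in> poly_fun n"
    unfolding h_def using is_subring_poly_fun
    by (intro is_subring_sum is_subringD(4) is_subring_prod is_subring_power const_poly_fun) auto
  moreover have "h (zero_extend x) = mpoly_eval p (x @ y)" if x: "length x = n" for x
  proof -
    have "v i (zero_extend x) = (x @ y) ! i" for i
      using x unfolding v_def zero_extend_def by (simp add: nth_append)
    then show ?thesis
      unfolding h_def mpoly_eval_def
      by (simp add: sum_fun_apply prod_fun_apply power_fun_apply times_fun_def)
  qed
  ultimately show ?thesis unfolding Bp by (intro bexI[of _ h]) auto
qed

lemma uncountable_zero_set_lepoll: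
  assumes H: "H \<subseteq> poly_fun n"
    and S: "S = {x. length x = n \<and> (\<forall>h\<in>H. h (zero_extend x) = 0)}"
    and unc: "uncountable S"
  shows "(UNIV :: real set) \<lesssim> S"
proof -
  have inj: "inj_on zero_extend S"
  proof (rule inj_onI)
    fix x y assume *: "x \<in> S" "y \<in> S" "zero_extend x = zero_extend y"
    show "x = y"
    proof (rule nth_equalityI)
      show len: "length x = length y" using * S by simp
      fix i assume "i < length x"
      then show "x ! i = y ! i" using len fun_cong[OF *(3), of i] unfolding zero_extend_def by simp
    qed
  qed
  have img: "zero_extend ` S = (\<Inter>i\<in>{n..}. {u. u i = 0}) \<inter> (\<Inter>h\<in>H. {u. h u = 0})" (is "_ = ?T")
  proof
    show "zero_extend ` S \<subseteq> ?T" unfolding S by (auto simp: zero_extend_def)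
    show "?T \<subseteq> zero_extend ` S"
    proof
      fix u assume u: "u \<in> ?T"
      have ux: "u = zero_extend (map u [0..<n])"
        using u by (auto simp: zero_extend_def fun_eq_iff not_less)
      then have "map u [0..<n] \<in> S" using u unfolding S by auto
      then show "u \<in> zero_extend ` S" by (subst ux) (rule imageI)
    qed
  qed
  have closed0: "closed {u :: nat \<Rightarrow> real. h u = 0}" if "continuous_on UNIV h" for h :: "(nat \<Rightarrow> real) \<Rightarrow> real"
    by (rule closed_Collect_eq[OF that continuous_on_const])
  have "closed ?T"
  proof (intro closed_Int closed_INT ballI)
    show "closed {u :: nat \<Rightarrow> real. u i = 0}" for i
      by (rule closed0) (rule continuous_on_product_coordinates)
    show "closed {u. h u = 0}" if "h \<in> H" for h
      by (rule closed0) (use that H continuous_poly_fun in blast)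
  qed
  moreover have "uncountable (zero_extend ` S)"
    using unc countable_image_inj_on[OF _ inj] by blast
  ultimately have "(UNIV :: real set) \<lesssim> zero_extend ` S"
    unfolding img by (intro uncountable_closed_lepoll)
  also have "zero_extend ` S \<lesssim> S" by (rule image_lepoll)
  finally show ?thesis .
qed

section \<open>Complete bipartite subgraphs and cardinal invariants\<close>

text \<open>
  The parts are automatically disjoint because \<open>G\<close> has no loops.
\<close>
lemma contains_K_aleph0_continuumI:
  assumes G: "is_graph G" and N: "infinite N" and X: "(UNIV :: nat set set) \<lesssim> X"
    and E: "X \<times> N \<subseteq> snd G"
  shows "contains_graph G K_aleph0_continuum"
proof -
  obtain f :: "nat \<Rightarrow> 'a" where f: "inj f" "range f \<subseteq> N" using infinite_countable_subset[OF N] by blast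
  obtain g :: "nat set \<Rightarrow> 'a" where g: "inj g" "range g \<subseteq> X" using X unfolding lepoll_def by blast
  have GE: "snd G \<subseteq> fst G \<times> fst G" "sym (snd G)" "irrefl (snd G)" using G unfolding is_graph_def by auto
  have gf: "(g s, f n) \<in> snd G" for s n using E f(2) g(2) by blast
  then have fg: "(f n, g s) \<in> snd G" for s n using GE(2) by (blast dest: symD)
  have ne: "f n \<noteq> g s" for s n using fg[of n s] GE(3) by (auto dest: irreflD)
  have V: "f n \<in> fst G" "g s \<in> fst G" for n s using fg GE(1) by auto
  define \<psi> where "\<psi> = case_sum f g"
  define H where "H = (range \<psi>, range f \<times> range g \<union> range g \<times> range f)"
  have inj: "inj \<psi>"
    unfolding \<psi>_def inj_on_def using injD[OF f(1)] injD[OF g(1)] ne ne[symmetric] by (auto split: sum.splits)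
  have rng: "range \<psi> = range f \<union> range g"
    unfolding \<psi>_def by (auto simp: image_iff split: sum.splits) (metis sum.case)+
  have "is_subgraph H G"
    unfolding is_subgraph_def is_graph_def H_def rng sym_def irrefl_def
    using gf fg V ne ne[symmetric] GE by (auto simp: irrefl_def sym_def)
  moreover have "graph_isomorphic H K_aleph0_continuum"
    unfolding graph_isomorphic_def
  proof (intro exI[of _ "inv \<psi>"] conjI ballI)
    show "bij_betw (inv \<psi>) (fst H) (fst K_aleph0_continuum)"
      using bij_betw_inv_into[OF inj_on_imp_bij_betw[OF inj]]
      unfolding H_def K_aleph0_continuum_def complete_bipartite_def by simp
    fix x y assume "x \<in> fst H" "y \<in> fst H"
    then obtain a b where ab: "x = \<psi> a" "y = \<psi> b" unfolding H_def by auto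
    show "(x, y) \<in> snd H \<longleftrightarrow> (inv \<psi> x, inv \<psi> y) \<in> snd K_aleph0_continuum"
      unfolding ab inv_f_f[OF inj]
      unfolding H_def K_aleph0_continuum_def complete_bipartite_def \<psi>_def
      using ne ne[symmetric] by (auto split: sum.splits)
  qed
  ultimately show ?thesis unfolding contains_graph_def by blast
qed

lemma contains_K_aleph0_continuumE:
  assumes "contains_graph G K_aleph0_continuum"
  obtains f :: "nat \<Rightarrow> 'a" and g :: "nat set \<Rightarrow> 'a"
  where "inj f" "inj g" "\<And>n s. f n \<noteq> g s" "range f \<subseteq> fst G" "range g \<subseteq> fst G"
    "\<And>n s. (f n, g s) \<in> snd G"
proof -
  obtain H \<phi> where H: "is_subgraph H G" and bij: "bij_betw \<phi> (fst H) (fst K_aleph0_continuum)"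
    and iso: "\<And>x y. x \<in> fst H \<Longrightarrow> y \<in> fst H \<Longrightarrow> (x, y) \<in> snd H \<longleftrightarrow> (\<phi> x, \<phi> y) \<in> snd K_aleph0_continuum"
    using assms unfolding contains_graph_def graph_isomorphic_def by blast
  define \<psi> where "\<psi> = inv_into (fst H) \<phi>"
  have bij: "bij_betw \<phi> (fst H) UNIV"
    using bij unfolding K_aleph0_continuum_def complete_bipartite_def by simp
  have \<psi>: "\<psi> a \<in> fst H" "\<phi> (\<psi> a) = a" for a
    unfolding \<psi>_def using bij by (auto simp: bij_betw_def inv_into_into f_inv_into_f)
  have inj: "\<psi> a = \<psi> b \<Longrightarrow> a = b" for a b using \<psi>(2) by metis
  have HG: "fst H \<subseteq> fst G" "snd H \<subseteq> snd G" using H unfolding is_subgraph_def by auto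
  show ?thesis
  proof (rule that[of "\<lambda>n. \<psi> (Inl n)" "\<lambda>s. \<psi> (Inr s)"])
    show "inj (\<lambda>n. \<psi> (Inl n))" "inj (\<lambda>s. \<psi> (Inr s))" by (auto intro!: injI dest: inj)
    show "\<psi> (Inl n) \<noteq> \<psi> (Inr s)" for n s using inj by blast
    show "range (\<lambda>n. \<psi> (Inl n)) \<subseteq> fst G" "range (\<lambda>s. \<psi> (Inr s)) \<subseteq> fst G" using \<psi> HG by auto
    show "(\<psi> (Inl n), \<psi> (Inr s)) \<in> snd G" for n s
    proof -
      have "(\<psi> (Inl n), \<psi> (Inr s)) \<in> snd H"
        unfolding iso[OF \<psi>(1) \<psi>(1)] \<psi>(2) K_aleph0_continuum_def complete_bipartite_def by simp
      then show ?thesis using HG by blast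
    qed
  qed
qed

text \<open>
  Take a set \<open>L\<close> of \<open>\<kappa>\<close> natural numbers and give the \<open>n\<close>-th vertex on the countable side the list
  \<open>{n} \<times> L\<close>. A colouring of that side selects a function \<open>k\<close> from \<open>\<nat>\<close> to \<open>L\<close>. There are at most
  continuum many such functions, so for each of them some vertex on the other side can be given the list
  \<open>{(n, k n) | n \<in> L}\<close>, all of whose colours are used up by its neighbours. For \<open>\<kappa> = 0\<close> there is no
  colouring at all.
\<close>
lemma not_choosable_if_contains_K:
  fixes G :: "'a graph" and \<kappa> :: "'a rel"
  assumes G: "contains_graph G K_aleph0_continuum" and \<kappa>: "Card_order \<kappa>" "\<kappa> \<le>o natLeq"
  shows "\<not> choosable G \<kappa>"
proof
  assume ch: "choosable G \<kappa>"
  obtain f :: "nat \<Rightarrow> 'a" and g :: "nat set \<Rightarrow> 'a" where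
    f: "inj f" and g: "inj g" and ne: "\<And>n s. f n \<noteq> g s"
    and V: "range f \<subseteq> fst G" "range g \<subseteq> fst G" and E: "\<And>n s. (f n, g s) \<in> snd G"
    using contains_K_aleph0_continuumE[OF G] by metis
  have "\<kappa> \<le>o |UNIV :: nat set|"
    using ordLeq_ordIso_trans[OF \<kappa>(2) ordIso_symmetric[OF card_of_nat]] .
  then have "|Field \<kappa>| \<le>o |UNIV :: nat set|"
    using card_of_Field_ordIso[OF \<kappa>(1)] ordIso_ordLeq_trans by blast
  then obtain e :: "'a \<Rightarrow> nat" where e: "inj_on e (Field \<kappa>)" 
    using card_of_ordLeq[of "Field \<kappa>" "UNIV :: nat set"] by blast
  define L where "L = e ` Field \<kappa>"
  have "|Field \<kappa>| =o |L|" using e unfolding L_def by (intro card_of_ordIsoI[of e]) (simp add: bij_betw_def)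
  then have L: "|L| =o \<kappa>"
    using card_of_Field_ordIso[OF \<kappa>(1)] ordIso_symmetric ordIso_transitive by blast
  define c :: "nat \<Rightarrow> nat \<Rightarrow> 'a + nat" where "c n j = Inr (prod_encode (n, j))" for n j
  have c: "c n j = c m k \<longleftrightarrow> n = m \<and> j = k" for n j m k unfolding c_def by simp
  \<comment> \<open>Functions are coded by their graphs, so that continuum many vertices can be indexed by them.\<close>
  define code where "code h = {prod_encode (n, h n) | n. True}" for h :: "nat \<Rightarrow> nat"
  have code: "h = h'" if "code h = code h'" for h h'
  proof
    fix n
    have "prod_encode (n, h n) \<in> code h" unfolding code_def by blast
    then have "prod_encode (n, h n) \<in> code h'" using that by simp
    then show "h n = h' n" unfolding code_def by simp
  qed
  define decode where "decode s = inv code s" for s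
  have decode: "decode (code h) = h" for h unfolding decode_def by (rule inv_f_f) (blast intro: injI code)
  define \<Lambda> where "\<Lambda> x = (if x \<in> range f then c (inv f x) ` L
     else if x \<in> range g then (\<lambda>n. c n (decode (inv g x) n)) ` L else c 0 ` L)" for x
  have \<Lambda>f: "\<Lambda> (f n) = c n ` L" for n unfolding \<Lambda>_def using f by simp
  have \<Lambda>g: "\<Lambda> (g s) = (\<lambda>n. c n (decode s n)) ` L" for s
    unfolding \<Lambda>_def using g ne[symmetric] by auto
  have im: "|k ` L| =o \<kappa>" if "inj_on k L" for k :: "nat \<Rightarrow> 'a + nat"
  proof -
    have "|L| =o |k ` L|" using that by (intro card_of_ordIsoI[of k]) (simp add: bij_betw_def)
    then show ?thesis using L ordIso_symmetric ordIso_transitive by blast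
  qed
  have "is_listing \<kappa> G \<Lambda>"
    unfolding is_listing_def \<Lambda>_def by (auto intro!: im inj_onI simp: c)
  then obtain \<phi> where proper: "proper_coloring G \<phi>" and lc: "list_coloring G \<Lambda> \<phi>"
    using ch unfolding choosable_def by blast
  have lc: "\<phi> x \<in> \<Lambda> x" if "x \<in> fst G" for x using lc that unfolding list_coloring_def by blast
  have \<phi>f: "\<phi> (f n) \<in> c n ` L" for n using lc[of "f n"] V(1) unfolding \<Lambda>f by blast
  then have "\<forall>n. \<exists>j. j \<in> L \<and> \<phi> (f n) = c n j" by blast
  then obtain k where k: "\<And>n. k n \<in> L" "\<And>n. \<phi> (f n) = c n (k n)" by metis
  let ?s = "code k"
  have "\<phi> (g ?s) \<in> (\<lambda>n. c n (k n)) ` L"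
    using lc[OF subsetD[OF V(2) rangeI], of ?s] unfolding \<Lambda>g decode by simp
  then obtain n where "\<phi> (g ?s) = \<phi> (f n)" using k by auto
  then show False using proper E[of n ?s] unfolding proper_coloring_def by fastforce
qed

lemma coloring_number_le_aleph0I:
  fixes G :: "real list graph"
  assumes r: "well_order_on (fst G) r" 
    and fin: "\<And>x. x \<in> fst G \<Longrightarrow> finite {y. (x, y) \<in> snd G \<and> y \<in> underS r x}"
  shows "coloring_number G \<le>o natLeq"
proof -
  \<comment> \<open>The invariants are compared with cardinal orders on the vertex type, so \<open>\<aleph>\<^sub>0\<close> is represented there.\<close>
  define A :: "real list set" where "A = range (\<lambda>n. replicate n 0)"
  have "inj (\<lambda>n. replicate n (0::real))" by (rule injI) (metis length_replicate)
  then have "|UNIV :: nat set| =o |A|" unfolding A_def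
    by (intro card_of_ordIsoI[of "\<lambda>n. replicate n 0"]) (simp add: bij_betw_def)
  then have A: "|A| =o natLeq" using card_of_nat ordIso_symmetric ordIso_transitive by blast
  have "has_coloring_order G |A|"
    unfolding has_coloring_order_def
  proof (intro exI conjI ballI)
    show "well_order_on (fst G) r" by (rule r)
    fix x assume "x \<in> fst G"
    have "finite {y \<in> fst G. (x, y) \<in> snd G \<and> y \<in> underS r x}"
      by (rule finite_subset[OF _ fin[OF \<open>x \<in> fst G\<close>]]) auto
    then have "|{y \<in> fst G. (x, y) \<in> snd G \<and> y \<in> underS r x}| <o natLeq"
      by (simp add: finite_iff_ordLess_natLeq)
    then show "|{y \<in> fst G. (x, y) \<in> snd G \<and> y \<in> underS r x}| <o |A|"
      using A ordIso_symmetric ordLess_ordIso_trans by blast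
  qed
  then have "coloring_number G \<le>o |A|"
    using coloring_number_exists[of G] card_of_Card_order unfolding is_least_cardinal_def by blast
  then show ?thesis using A ordLeq_ordIso_trans by blast
qed

section \<open>The equivalence\<close>

text \<open>
  The points of the piece \<open>A\<close> of the vertex set that are joined to each \<open>y\<close> in \<open>ys\<close> by the corresponding
  piece of the edge relation.
\<close>
definition solution_set :: "real list set \<Rightarrow> real list set list \<Rightarrow> real list list \<Rightarrow> real list set" where
  "solution_set A Bs ys = {x \<in> A. \<forall>(B, y)\<in>set (zip Bs ys). x @ y \<in> B}"

text \<open>
  The operations under which vertex sets will be closed. Closedness plays the role that membership of
  all coordinates in an algebraically closed field of definition has in the classical argument.
  Adding only the countable solution sets, rather than the finite ones, suffices, and leaves
  uncountable ones to the Cantor--Bendixson argument.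
\<close>
definition countable_solutions ::
    "real list set set \<Rightarrow> real list set set \<Rightarrow> real list list \<Rightarrow> real list set" where
  "countable_solutions \<A> \<B> ys =
     \<Union>{Z. \<exists>A\<in>\<A>. \<exists>Bs\<in>lists \<B>. Z = solution_set A Bs ys \<and> countable Z}"

lemma countable_countable_solutions:
  assumes "countable \<A>" "countable \<B>"
  shows "countable (countable_solutions \<A> \<B> ys)"
proof -
  have "countable ((\<lambda>(A, Bs). solution_set A Bs ys) ` (\<A> \<times> lists \<B>))"
    using assms by (intro countable_image countable_SIGMA countable_lists)
  moreover have "{Z. \<exists>A\<in>\<A>. \<exists>Bs\<in>lists \<B>. Z = solution_set A Bs ys \<and> countable Z}
      \<subseteq> (\<lambda>(A, Bs). solution_set A Bs ys) ` (\<A> \<times> lists \<B>)" by force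
  ultimately have "countable {Z. \<exists>A\<in>\<A>. \<exists>Bs\<in>lists \<B>. Z = solution_set A Bs ys \<and> countable Z}"
    using countable_subset by blast
  then have "countable (\<Union>Z\<in>{Z. \<exists>A\<in>\<A>. \<exists>Bs\<in>lists \<B>. Z = solution_set A Bs ys \<and> countable Z}. Z)"
    by (rule countable_UN) blast
  then show ?thesis unfolding countable_solutions_def by simp
qed

text \<open>
  Let \<open>N\<close> be the infinite set of neighbours of \<open>x\<close> in the closed set \<open>K\<close>. For each \<open>y\<close> in \<open>N\<close> fix an algebraic
  piece \<open>B y\<close> of the edge relation that joins \<open>x\<close> to \<open>y\<close>, and a piece \<open>A\<close> of the vertex set that contains \<open>x\<close>.
  By the basis theorem finitely many members of \<open>N\<close> define the same points \<open>z\<close> of \<open>A\<close>, joined to them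
  in this way, as all of \<open>N\<close> do. So the solution set \<open>Z\<close> for these finitely many \<open>y\<close> is completely joined
  to \<open>N\<close>. It contains \<open>x\<close>, which is outside \<open>K\<close>, hence it is not countable, and so has the cardinality of
  the continuum.
\<close>
lemma contains_K_if_infinite_back_neighbours:
  assumes G: "is_graph G"
    and \<A>: "\<And>A. A \<in> \<A> \<Longrightarrow> algebraic_set n A" and V: "fst G = \<Union>\<A>"
    and \<B>: "\<And>B. B \<in> \<B> \<Longrightarrow> algebraic_set (2 * n) B" and E: "(\<lambda>(x, y). x @ y) ` snd G = \<Union>\<B>"
    and K: "op_closed (countable_solutions \<A> \<B>) K"
    and x: "x \<in> fst G" "x \<notin> K"
    and inf: "infinite {y \<in> K. (x, y) \<in> snd G}"
  shows "contains_graph G K_aleph0_continuum"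
proof -
  define N where "N = {y \<in> K. (x, y) \<in> snd G}"
  have len: "length y = n" if "y \<in> fst G" for y
    using that V \<A> unfolding algebraic_set_def by blast
  have EV: "snd G \<subseteq> fst G \<times> fst G" using G unfolding is_graph_def by blast
  have lenN: "length y = n" if "y \<in> N" for y using that EV len unfolding N_def by blast
  have edge: "(x', y) \<in> snd G" if B: "B \<in> \<B>" "x' @ y \<in> B" and l: "length x' = n" for x' y B
  proof -
    have "x' @ y \<in> (\<lambda>(x, y). x @ y) ` snd G" using B E by blast
    then obtain a b where ab: "(a, b) \<in> snd G" "x' @ y = a @ b" by auto
    then have "length a = n" using EV len by blast
    then show ?thesis using ab l by simp
  qed
  obtain A where A: "A \<in> \<A>" "x \<in> A" using x V by blast
  obtain g where g: "g \<in> poly_fun n" and gA: "\<And>x. length x = n \<Longrightarrow> g (zero_extend x) = 0 \<longleftrightarrow> x \<in> A"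
    using algebraic_section[of n "[]" A] \<A>[OF A(1)] by auto
  have "\<exists>B. B \<in> \<B> \<and> x @ y \<in> B" if "y \<in> N" for y
  proof -
    have "x @ y \<in> (\<lambda>(x, y). x @ y) ` snd G" using that unfolding N_def by force
    then show ?thesis using E by blast
  qed
  then obtain B where B: "\<And>y. y \<in> N \<Longrightarrow> B y \<in> \<B>" "\<And>y. y \<in> N \<Longrightarrow> x @ y \<in> B y" by metis
  have "\<exists>h. h \<in> poly_fun n \<and> (\<forall>x. length x = n \<longrightarrow> (h (zero_extend x) = 0 \<longleftrightarrow> x @ y \<in> B y))"
    if "y \<in> N" for y
    using algebraic_section[of n y "B y"] \<B>[OF B(1)[OF that]] lenN[OF that] by (auto simp: mult_2)
  then obtain h where h: "\<And>y. y \<in> N \<Longrightarrow> h y \<in> poly_fun n"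
    and hB: "\<And>x y. y \<in> N \<Longrightarrow> length x = n \<Longrightarrow> h y (zero_extend x) = 0 \<longleftrightarrow> x @ y \<in> B y"
    by metis
  have "h ` N \<subseteq> poly_fun n" using h by blast
  then obtain F where F: "F \<subseteq> h ` N" "finite F"
    and FN: "\<And>u. (\<forall>f\<in>F. f u = 0) \<Longrightarrow> (\<forall>f\<in>h ` N. f u = 0)" 
    using finite_subsystem by metis
  obtain N0 where N0: "N0 \<subseteq> N" "finite N0" "F = h ` N0"
    using finite_subset_image[OF F(2,1)] by blast
  obtain ys where ys: "set ys = N0" using finite_list[OF N0(2)] by blast
  define Z where "Z = solution_set A (map B ys) ys"
  have zip: "set (zip (map B ys) ys) = (\<lambda>y. (B y, y)) ` N0"
    by (simp add: zip_map1 zip_same_conv_map ys[symmetric])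
  have Z: "Z = {x. length x = n \<and> (\<forall>f\<in>insert g (h ` N0). f (zero_extend x) = 0)}"
  proof -
    have "z \<in> Z \<longleftrightarrow> length z = n \<and> g (zero_extend z) = 0 \<and> (\<forall>y\<in>N0. h y (zero_extend z) = 0)" for z
    proof (cases "length z = n")
      case True
      have "z \<in> Z \<longleftrightarrow> z \<in> A \<and> (\<forall>y\<in>N0. z @ y \<in> B y)"
        unfolding Z_def solution_set_def zip by auto
      also have "\<dots> \<longleftrightarrow> g (zero_extend z) = 0 \<and> (\<forall>y\<in>N0. h y (zero_extend z) = 0)"
        unfolding gA[OF True] using hB[OF subsetD[OF N0(1)] True] by simp
      finally show ?thesis using True by simp
    next
      case False
      then have "z \<notin> A" using len[of z] A(1) unfolding V by blast
      then show ?thesis using False unfolding Z_def solution_set_def by simp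
    qed
    then show ?thesis by auto
  qed
  have "x \<in> Z"
    unfolding Z_def solution_set_def zip using A(2) B(2) N0(1) by auto
  have "uncountable Z"
  proof
    assume "countable Z"
    moreover have "map B ys \<in> lists \<B>" using B(1)[OF subsetD[OF N0(1)]] ys by auto
    ultimately have "Z \<subseteq> countable_solutions \<A> \<B> ys"
      using A(1) unfolding countable_solutions_def Z_def by blast
    also have "\<dots> \<subseteq> K"
      using K ys N0(1) unfolding op_closed_def N_def by auto
    finally show False using \<open>x \<in> Z\<close> x(2) by blast
  qed
  then have "(UNIV :: real set) \<lesssim> Z"
    by (rule uncountable_zero_set_lepoll[OF _ Z, rotated]) (use g h N0(1) in auto)
  then have "(UNIV :: nat set set) \<lesssim> Z"
    using lepoll_trans1[OF nat_sets_eqpoll_reals] by blast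
  moreover have "Z \<times> N \<subseteq> snd G"
  proof (rule subrelI, elim SigmaE2)
    fix z y assume z: "z \<in> Z" and y: "y \<in> N"
    then have l: "length z = n" and z0: "\<forall>f\<in>F. f (zero_extend z) = 0"
      unfolding N0(3) Z by auto
    have "h y (zero_extend z) = 0" using FN[OF z0] y by blast
    then have "z @ y \<in> B y" using hB[OF y l] by simp
    then show "(z, y) \<in> snd G" by (rule edge[OF B(1)[OF y] _ l])
  qed
  ultimately show ?thesis
    using contains_K_aleph0_continuumI[OF G inf[folded N_def]] by blast
qed

theorem theorem1p3:
  fixes G :: "real list graph"
  assumes "sigma_algebraic_graph G"
  shows "(list_chromatic_number G \<le>o natLeq \<longleftrightarrow> coloring_number G \<le>o natLeq) \<and>
         (coloring_number G \<le>o natLeq \<longleftrightarrow> \<not> contains_graph G K_aleph0_continuum)"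
proof -
  obtain n where G: "is_graph G" and "sigma_algebraic_set n (fst G)"
    and "sigma_algebraic_set (2 * n) ((\<lambda>(x, y). x @ y) ` snd G)"
    using assms unfolding sigma_algebraic_graph_def by blast
  then obtain \<A> \<B> where \<A>: "countable \<A>" "\<forall>A\<in>\<A>. algebraic_set n A" and V: "fst G = \<Union>\<A>"
    and \<B>: "countable \<B>" "\<forall>B\<in>\<B>. algebraic_set (2 * n) B"
    and E: "(\<lambda>(x, y). x @ y) ` snd G = \<Union>\<B>"
    unfolding sigma_algebraic_set_def by (elim exE conjE)
  have list: "is_least_cardinal (choosable G) (list_chromatic_number G)"
    by (rule list_chromatic_number_exists[OF G])
  have col: "is_least_cardinal (has_coloring_order G) (coloring_number G)"
    by (rule coloring_number_exists)
  have "list_chromatic_number G \<le>o coloring_number G"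
    using list col choosable_if_has_coloring_order[OF G] unfolding is_least_cardinal_def by blast
  then have "list_chromatic_number G \<le>o natLeq" if "coloring_number G \<le>o natLeq"
    using that ordLeq_transitive by blast
  moreover have "\<not> contains_graph G K_aleph0_continuum" if "list_chromatic_number G \<le>o natLeq"
    using not_choosable_if_contains_K[OF _ _ that] list unfolding is_least_cardinal_def by blast
  moreover have "coloring_number G \<le>o natLeq" if no: "\<not> contains_graph G K_aleph0_continuum"
  proof -
    have "op_closed (countable_solutions \<A> \<B>) (fst G)"
      unfolding op_closed_def countable_solutions_def solution_set_def V by auto
    moreover have "finite {y \<in> K. (x, y) \<in> snd G}"
      if "op_closed (countable_solutions \<A> \<B>) K" "x \<in> fst G - K" for K x
      using contains_K_if_infinite_back_neighbours[OF G bspec[OF \<A>(2)] V bspec[OF \<B>(2)] E that(1)] that(2) no by blast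
    ultimately have "\<exists>r. finite_back_degree (snd G) (fst G) r"
      by (rule finite_back_degree_closed[OF countable_countable_solutions[OF \<A>(1) \<B>(1)]])
    then show ?thesis
      unfolding finite_back_degree_def using coloring_number_le_aleph0I[of G] by blast
  qed
  ultimately show ?thesis by blast
qed

end
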